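(* For every countable theory $T\subseteq\mathcal{L}_{\square\Diamond}$ and every formula $\varphi\in\mathcal{L}_{\square\Diamond}$: (i) $T\vdash_{\mathcal{G}T_{\square\Diamond}}\varphi$ if and only if $T\models_{Ref}\varphi$; (ii) $T\vdash_{\mathcal{G}S4_{\square\Diamond}}\varphi$ if and only if $T\models_{Ref\cap Trans}\varphi$; (iii) $T\vdash_{\mathcal{G}S5_{\square\Diamond}}\varphi$ if and only if $T\models_{Ref\cap Trans\cap Symm}\varphi$.
   Context: Language: $Var$ is a set of propositional variables; $\mathcal{L}_{\square\Diamond}=\mathcal{L}_{\square\Diamond}(Var)$ is the set of formulas built from $Var$ and $\bot$ using the binary connectives $\wedge,\vee,\rightarrow$ and the unary modal operators $\square,\Diamond$. Abbreviation: $\lnot\varphi:=\varphi\rightarrow\bot$. A theory is a set of formulas. Semantics: on $[0,1]$ let $a\cdot b=\min(a,b)$, $a\curlyvee b=\max(a,b)$, and $a\Rightarrow b=1$ if $a\le b$, $a\Rightarrow b=b$ otherwise. A GK-model is $M=\langle W,S,e\rangle$ with $W$ a non-empty set of worlds and $S:W\times W\to[0,1]$, $e:W\times Var\to[0,1]$ arbitrary functions. The function $e$ extends to $W\times\mathcal{L}_{\square\Diamond}$ by $e(x,\bot)=0$, $e(x,\varphi\wedge\psi)=e(x,\varphi)\cdot e(x,\psi)$, $e(x,\varphi\vee\psi)=e(x,\varphi)\curlyvee e(x,\psi)$, $e(x,\varphi\rightarrow\psi)=e(x,\varphi)\Rightarrow e(x,\psi)$, $e(x,\square\varphi)=\inf_{y\in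 W}\{Sxy\Rightarrow e(y,\varphi)\}$, $e(x,\Diamond\varphi)=\sup_{y\in W}\{Sxy\cdot e(y,\varphi)\}$. $Ref$, $Trans$, $Symm$ are the classes of GK-models such that, respectively, $Sxx=1$ for all $x$; $Sxy\cdot Syz\le Sxz$ for all $x,y,z$; $Sxy=Syx$ for all $x,y$. For a class $\mathcal{C}$ of GK-models, $T\models_{\mathcal{C}}\varphi$ means: for every $M=\langle W,S,e\rangle\in\mathcal{C}$ and every $x\in W$, if $e(x,\theta)=1$ for all $\theta\in T$ then $e(x,\varphi)=1$. Calculi: $\mathcal{G}_{\square\Diamond}$ consists of an axiomatization (with Modus Ponens) of Gödel–Dummett propositional logic, i.e. Heyting (intuitionistic) propositional calculus plus the prelinearity axiom $(\varphi\rightarrow\psi)\vee(\psi\rightarrow\varphi)$, for all formulas of $\mathcal{L}_{\square\Diamond}$, together with the axiom schemes $\square(\varphi\rightarrow\psi)\rightarrow(\square\varphi\rightarrow\square\psi)$; $\Diamond(\varphi\vee\psi)\rightarrow(\Diamond\varphi\vee\Diamond\psi)$; $\lnot\Diamond\bot$; $\Diamond(\varphi\rightarrow\psi)\rightarrow(\square\varphi\rightarrow\Diamond\psi)$; $(\Diamond\varphi\rightarrow\square\psi)\rightarrow\square(\varphi\rightarrow\psi)$; and the inference rules: from $\varphi$ infer $\square\varphi$; from $\varphi\rightarrow\psi$ infer $\Diamond\varphi\rightarrow\Diamond\psi$. $\mathcal{G}T_{\square\Diamond}$ is $\mathcal{G}_{\square\Diamond}$ plus the axiom schemes $\square\varphi\rightarrow\varphi$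 and $\varphi\rightarrow\Diamond\varphi$. $\mathcal{G}S4_{\square\Diamond}$ is $\mathcal{G}T_{\square\Diamond}$ plus $\square\varphi\rightarrow\square\square\varphi$ and $\Diamond\Diamond\varphi\rightarrow\Diamond\varphi$. $\mathcal{G}S5_{\square\Diamond}$ is $\mathcal{G}S4_{\square\Diamond}$ plus $\varphi\rightarrow\square\Diamond\varphi$ and $\Diamond\square\varphi\rightarrow\varphi$. For each of these systems $\mathcal{S}$, $T\vdash_{\mathcal{S}}\varphi$ denotes derivability of $\varphi$ from assumptions $T$, where the two modal rules may be applied only when the premise is a theorem of $\mathcal{S}$ (derivable in $\mathcal{S}$ without assumptions). *)

theory Defs
  imports Complex_Main "HOL-Library.Countable_Set"
begin

datatype 'v fm =
    Atom 'v
  | Bot (\<open>\<^bold>\<bottom>\<close>)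
  | And "'v fm" "'v fm" (infixr \<open>\<^bold>\<and>\<close> 72)
  | Or "'v fm" "'v fm" (infixr \<open>\<^bold>\<or>\<close> 71)
  | Imp "'v fm" "'v fm" (infixr \<open>\<^bold>\<rightarrow>\<close> 70)
  | Box "'v fm" (\<open>\<^bold>\<box> _\<close> [75] 75)
  | Dia "'v fm" (\<open>\<^bold>\<diamond> _\<close> [75] 75)

abbreviation Neg :: "'v fm \<Rightarrow> 'v fm" (\<open>\<^bold>\<not> _\<close> [75] 75) where
  "\<^bold>\<not> \<phi> \<equiv> \<phi> \<^bold>\<rightarrow> \<^bold>\<bottom>"

subsection \<open>Semantics\<close>

definition gimp :: "real \<Rightarrow> real \<Rightarrow> real" (infixr \<open>\<Rightarrow>\<^sub>G\<close> 60) where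
  "a \<Rightarrow>\<^sub>G b = (if a \<le> b then 1 else b)"

text \<open>The worlds form a subset of a type \<open>'w\<close>. Only the values of \<open>acc\<close> and \<open>val\<close> at worlds
  matter; these are required to lie in the unit interval, so that the infima and suprema of reals
  in \<open>eval\<close> range over bounded non-empty sets and agree with those of the lattice $[0,1]$.\<close>

record ('w, 'v) gk_struct =
  worlds :: "'w set"
  acc :: "'w \<Rightarrow> 'w \<Rightarrow> real"
  val :: "'w \<Rightarrow> 'v \<Rightarrow> real"

definition GK :: "('w, 'v) gk_struct set" where
  "GK = {M. worlds M \<noteq> {} \<and>
            (\<forall>x\<in>worlds M. \<forall>y\<in>worlds M. acc M x y \<in> {0..1}) \<and>
            (\<forall>x\<in>worlds M. \<forall>p. val M x p \<in> {0..1})}"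

primrec eval :: "('w, 'v) gk_struct \<Rightarrow> 'w \<Rightarrow> 'v fm \<Rightarrow> real" where
  "eval M x (Atom p) = val M x p"
| "eval M x \<^bold>\<bottom> = 0"
| "eval M x (\<phi> \<^bold>\<and> \<psi>) = min (eval M x \<phi>) (eval M x \<psi>)"
| "eval M x (\<phi> \<^bold>\<or> \<psi>) = max (eval M x \<phi>) (eval M x \<psi>)"
| "eval M x (\<phi> \<^bold>\<rightarrow> \<psi>) = (eval M x \<phi> \<Rightarrow>\<^sub>G eval M x \<psi>)"
| "eval M x (\<^bold>\<box> \<phi>) = (INF y\<in>worlds M. acc M x y \<Rightarrow>\<^sub>G eval M y \<phi>)"
| "eval M x (\<^bold>\<diamond> \<phi>) = (SUP y\<in>worlds M. min (acc M x y) (eval M y \<phi>))"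

definition Ref :: "('w, 'v) gk_struct set" where
  "Ref = {M \<in> GK. \<forall>x\<in>worlds M. acc M x x = 1}"

definition Trans :: "('w, 'v) gk_struct set" where
  "Trans = {M \<in> GK. \<forall>x\<in>worlds M. \<forall>y\<in>worlds M. \<forall>z\<in>worlds M.
              min (acc M x y) (acc M y z) \<le> acc M x z}"

definition Symm :: "('w, 'v) gk_struct set" where
  "Symm = {M \<in> GK. \<forall>x\<in>worlds M. \<forall>y\<in>worlds M. acc M x y = acc M y x}"

text \<open>HOL cannot quantify over all types inside a formula, so the class \<open>C\<close> consists of models
  with worlds in a fixed type \<open>'w\<close>. It represents the class of all models once \<open>'w\<close> is infinite:
  then subsets of \<open>'w\<close> provide world sets of every finite size as well. An infinite \<open>'w\<close> is needed,
  since models of bounded size validate formulas that fail in larger models; it loses nothing for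
  countable \<open>T\<close>, because the infima and suprema arising for countably many formulas are already
  determined by a countable submodel (Loewenheim-Skolem).\<close>

definition entails :: "'v fm set \<Rightarrow> ('w, 'v) gk_struct set \<Rightarrow> 'v fm \<Rightarrow> bool"
    (\<open>(_ \<Turnstile>\<^bsub>_\<^esub> _)\<close> [51, 0, 51] 50) where
  "T \<Turnstile>\<^bsub>C\<^esub> \<phi> \<longleftrightarrow>
     (\<forall>M\<in>C. \<forall>x\<in>worlds M. (\<forall>\<theta>\<in>T. eval M x \<theta> = 1) \<longrightarrow> eval M x \<phi> = 1)"

subsection \<open>Calculi\<close>

text \<open>Heyting propositional calculus plus prelinearity.\<close>

inductive_set Goedel_ax :: "'v fm set" where
  "\<phi> \<^bold>\<rightarrow> \<psi> \<^bold>\<rightarrow> \<phi> \<in> Goedel_ax"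
| "(\<phi> \<^bold>\<rightarrow> \<psi> \<^bold>\<rightarrow> \<chi>) \<^bold>\<rightarrow> (\<phi> \<^bold>\<rightarrow> \<psi>) \<^bold>\<rightarrow> \<phi> \<^bold>\<rightarrow> \<chi> \<in> Goedel_ax"
| "\<phi> \<^bold>\<and> \<psi> \<^bold>\<rightarrow> \<phi> \<in> Goedel_ax"
| "\<phi> \<^bold>\<and> \<psi> \<^bold>\<rightarrow> \<psi> \<in> Goedel_ax"
| "\<phi> \<^bold>\<rightarrow> \<psi> \<^bold>\<rightarrow> \<phi> \<^bold>\<and> \<psi> \<in> Goedel_ax"
| "\<phi> \<^bold>\<rightarrow> \<phi> \<^bold>\<or> \<psi> \<in> Goedel_ax"
| "\<psi> \<^bold>\<rightarrow> \<phi> \<^bold>\<or> \<psi> \<in> Goedel_ax"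
| "(\<phi> \<^bold>\<rightarrow> \<chi>) \<^bold>\<rightarrow> (\<psi> \<^bold>\<rightarrow> \<chi>) \<^bold>\<rightarrow> \<phi> \<^bold>\<or> \<psi> \<^bold>\<rightarrow> \<chi> \<in> Goedel_ax"
| "\<^bold>\<bottom> \<^bold>\<rightarrow> \<phi> \<in> Goedel_ax"
| "(\<phi> \<^bold>\<rightarrow> \<psi>) \<^bold>\<or> (\<psi> \<^bold>\<rightarrow> \<phi>) \<in> Goedel_ax"

text \<open>The calculi differ only in their axioms; each is identified with its set of axioms.\<close>

inductive_set G_BD :: "'v fm set" where
  "\<phi> \<in> Goedel_ax \<Longrightarrow> \<phi> \<in> G_BD"
| "\<^bold>\<box> (\<phi> \<^bold>\<rightarrow> \<psi>) \<^bold>\<rightarrow> (\<^bold>\<box> \<phi> \<^bold>\<rightarrow> \<^bold>\<box> \<psi>) \<in> G_BD"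
| "\<^bold>\<diamond> (\<phi> \<^bold>\<or> \<psi>) \<^bold>\<rightarrow> (\<^bold>\<diamond> \<phi> \<^bold>\<or> \<^bold>\<diamond> \<psi>) \<in> G_BD"
| "\<^bold>\<not> (\<^bold>\<diamond> \<^bold>\<bottom>) \<in> G_BD"
| "\<^bold>\<diamond> (\<phi> \<^bold>\<rightarrow> \<psi>) \<^bold>\<rightarrow> (\<^bold>\<box> \<phi> \<^bold>\<rightarrow> \<^bold>\<diamond> \<psi>) \<in> G_BD"
| "(\<^bold>\<diamond> \<phi> \<^bold>\<rightarrow> \<^bold>\<box> \<psi>) \<^bold>\<rightarrow> \<^bold>\<box> (\<phi> \<^bold>\<rightarrow> \<psi>) \<in> G_BD"

inductive_set GT_BD :: "'v fm set" where
  "\<phi> \<in> G_BD \<Longrightarrow> \<phi> \<in> GT_BD"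
| "\<^bold>\<box> \<phi> \<^bold>\<rightarrow> \<phi> \<in> GT_BD"
| "\<phi> \<^bold>\<rightarrow> \<^bold>\<diamond> \<phi> \<in> GT_BD"

inductive_set GS4_BD :: "'v fm set" where
  "\<phi> \<in> GT_BD \<Longrightarrow> \<phi> \<in> GS4_BD"
| "\<^bold>\<box> \<phi> \<^bold>\<rightarrow> \<^bold>\<box> (\<^bold>\<box> \<phi>) \<in> GS4_BD"
| "\<^bold>\<diamond> (\<^bold>\<diamond> \<phi>) \<^bold>\<rightarrow> \<^bold>\<diamond> \<phi> \<in> GS4_BD"

inductive_set GS5_BD :: "'v fm set" where
  "\<phi> \<in> GS4_BD \<Longrightarrow> \<phi> \<in> GS5_BD"
| "\<phi> \<^bold>\<rightarrow> \<^bold>\<box> (\<^bold>\<diamond> \<phi>) \<in> GS5_BD"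
| "\<^bold>\<diamond> (\<^bold>\<box> \<phi>) \<^bold>\<rightarrow> \<phi> \<in> GS5_BD"

inductive derives :: "'v fm set \<Rightarrow> 'v fm set \<Rightarrow> 'v fm \<Rightarrow> bool"
    (\<open>(_ \<turnstile>\<^bsub>_\<^esub> _)\<close> [51, 0, 51] 50) where
  Assm: "\<phi> \<in> T \<Longrightarrow> T \<turnstile>\<^bsub>\<S>\<^esub> \<phi>"
| Ax: "\<phi> \<in> \<S> \<Longrightarrow> T \<turnstile>\<^bsub>\<S>\<^esub> \<phi>"
| MP: "T \<turnstile>\<^bsub>\<S>\<^esub> \<phi> \<^bold>\<rightarrow> \<psi> \<Longrightarrow> T \<turnstile>\<^bsub>\<S>\<^esub> \<phi> \<Longrightarrow> T \<turnstile>\<^bsub>\<S>\<^esub> \<psi>"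
| Nec: "{} \<turnstile>\<^bsub>\<S>\<^esub> \<phi> \<Longrightarrow> T \<turnstile>\<^bsub>\<S>\<^esub> \<^bold>\<box> \<phi>"
| DiaMono: "{} \<turnstile>\<^bsub>\<S>\<^esub> \<phi> \<^bold>\<rightarrow> \<psi> \<Longrightarrow> T \<turnstile>\<^bsub>\<S>\<^esub> \<^bold>\<diamond> \<phi> \<^bold>\<rightarrow> \<^bold>\<diamond> \<psi>"

end

theory Submission
  imports Defs
begin

text \<open>Completeness is proved by building a countable canonical model directly. A world is a prime
  theory \<open>P\<close>, whose formulas are linearly preordered by \<open>\<phi> \<rightarrow> \<psi> \<in> P\<close>; the preorders of all worlds live in
  one common countable chain, which grows by one world at a time. If the value of \<open>\<box>\<psi>\<close> at a world is
  below 1, some prime theory \<open>Q\<close> omits \<open>\<psi>\<close>, contains every \<open>\<chi>\<close> with \<open>\<box>\<chi>\<close> above this value and omits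
  every \<open>\<delta>\<close> with \<open>\<diamond>\<delta>\<close> not above it; the axioms allow the chain of \<open>Q\<close> to be merged with the old one so
  that \<open>\<chi>\<close> at the new world lies between \<open>\<box>\<chi>\<close> and \<open>\<diamond>\<chi>\<close> at the old one (up to a bound \<open>s\<close> inserted just above
  the value of \<open>\<box>\<psi>\<close>), and dually for \<open>\<diamond>\<psi>\<close>. Every such task is repeated infinitely often, so the values
  of modal formulas become limits in the chain. An order embedding into [0,1] by successive midpoints is
  continuous at such limits, hence turns them into infima and suprema. Accessibility is taken as large as
  the modal values permit, so that the axioms of the three systems give reflexivity, transitivity and
  symmetry outright.\<close>

subsection \<open>Infima, suprema and residuation in the unit interval\<close>

text \<open>A prime theory orders only its own formulas, whereas modal values compare formulas of
  different worlds. As T may be infinite, one cannot restrict to finitely many relevant values and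
  rescale them to fit a witness; so the order comes first, old comparisons are never revised, and
  numbers are assigned only at the end. Each witness is tied to an initial segment \<open>I\<close>
  of the old chain. All formulas of Q get the top value and the others stay below the bound that
  closes \<open>I\<close>, so nothing above \<open>I\<close> has to be matched. Two axioms make the
  merge consistent: (\<diamond>\<phi> \<rightarrow> \<box>\<psi>) \<rightarrow> \<box>(\<phi>
  \<rightarrow> \<psi>) turns a forced path \<phi> \<le> \<diamond>\<phi> \<le> \<box>\<psi> \<le>
  \<psi> through the old chain into an inequality of Q, and \<diamond>(\<phi> \<rightarrow> \<psi>)
  \<rightarrow> (\<box>\<phi> \<rightarrow> \<diamond>\<psi>) turns a path \<box>\<phi> \<le> \<phi>
  \<le> \<psi> \<le> \<diamond>\<psi> through Q into one of the old chain. The bound must be strict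
  because \<open>a \<Rightarrow>\<^sub>G b\<close> equals b below 1 only if b < a. One witness gets
  \<psi> below the bound, not necessarily down to \<box>\<psi>; hence the repetition.\<close>

lemma le_gimp_iff: "c \<le> 1 \<Longrightarrow> c \<le> (a \<Rightarrow>\<^sub>G b) \<longleftrightarrow> min c a \<le> b"
  by (auto simp: gimp_def)

lemma gimp_eq_1_iff: "a \<le> 1 \<Longrightarrow> (a \<Rightarrow>\<^sub>G b) = 1 \<longleftrightarrow> a \<le> b"
  by (auto simp: gimp_def)

lemma gimp_unit: "b \<in> {0..1} \<Longrightarrow> (a \<Rightarrow>\<^sub>G b) \<in> {0..1}"
  by (auto simp: gimp_def)

lemma cINF_unit:
  fixes f :: "'a \<Rightarrow> real"
  assumes "A \<noteq> {}" "\<And>x. x \<in> A \<Longrightarrow> f x \<in> {0..1}"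
  shows "(INF x\<in>A. f x) \<in> {0..1}" "c \<le> (INF x\<in>A. f x) \<longleftrightarrow> (\<forall>x\<in>A. c \<le> f x)"
proof -
  have bdd: "bdd_below (f ` A)" using assms by (intro bdd_belowI[of _ 0]) auto
  show *: "c \<le> (INF x\<in>A. f x) \<longleftrightarrow> (\<forall>x\<in>A. c \<le> f x)" for c
    by (rule le_cINF_iff[OF assms(1) bdd])
  obtain x where "x \<in> A" using assms(1) by auto
  then have "(INF x\<in>A. f x) \<le> 1" using cINF_lower[OF bdd, of x] assms(2)[of x] by auto
  moreover have "0 \<le> (INF x\<in>A. f x)" using * assms by auto
  ultimately show "(INF x\<in>A. f x) \<in> {0..1}" by simp
qed

lemma cSUP_unit:
  fixes f :: "'a \<Rightarrow> real"
  assumes "A \<noteq> {}" "\<And>x. x \<in> A \<Longrightarrow> f x \<in> {0..1}"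
  shows "(SUP x\<in>A. f x) \<in> {0..1}" "(SUP x\<in>A. f x) \<le> c \<longleftrightarrow> (\<forall>x\<in>A. f x \<le> c)"
proof -
  have bdd: "bdd_above (f ` A)" using assms by (intro bdd_aboveI[of _ 1]) auto
  show *: "(SUP x\<in>A. f x) \<le> c \<longleftrightarrow> (\<forall>x\<in>A. f x \<le> c)" for c
    by (rule cSUP_le_iff[OF assms(1) bdd])
  obtain x where "x \<in> A" using assms(1) by auto
  then have "0 \<le> (SUP x\<in>A. f x)" using cSUP_upper[OF _ bdd, of x] assms(2)[of x] by force
  moreover have "(SUP x\<in>A. f x) \<le> 1" using * assms by auto
  ultimately show "(SUP x\<in>A. f x) \<in> {0..1}" by simp
qed

subsection \<open>Soundness\<close>

lemma GK_D:
  assumes "M \<in> GK"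
  shows "worlds M \<noteq> {}"
    and "x \<in> worlds M \<Longrightarrow> y \<in> worlds M \<Longrightarrow> acc M x y \<in> {0..1}"
    and "x \<in> worlds M \<Longrightarrow> val M x p \<in> {0..1}"
  using assms by (auto simp: GK_def)

lemma eval_unit:
  assumes "M \<in> GK" "x \<in> worlds M"
  shows "eval M x \<phi> \<in> {0..1}"
  using assms(2)
proof (induction \<phi> arbitrary: x)
  case (Box \<phi>)
  then show ?case using GK_D[OF assms(1)]
    by (auto intro!: cINF_unit(1) gimp_unit simp del: atLeastAtMost_iff)
next
  case (Dia \<phi>)
  have "min (acc M x y) (eval M y \<phi>) \<in> {0..1}" if "y \<in> worlds M" for y
    using GK_D(2)[OF assms(1) Dia.prems that] Dia.IH[OF that] by auto
  then show ?case using GK_D(1)[OF assms(1)] by (auto intro!: cSUP_unit(1) simp del: atLeastAtMost_iff)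
qed (use GK_D[OF assms(1)] in \<open>auto simp: gimp_def min_le_iff_disj le_max_iff_disj\<close>)

lemma eval_le_1: "M \<in> GK \<Longrightarrow> x \<in> worlds M \<Longrightarrow> eval M x \<phi> \<le> 1"
  using eval_unit by fastforce

text \<open>Residuation moves the accessibility degree to the left, so box, like diamond, becomes a
  family of inequalities between minima. Validity of the modal axioms is then mostly linear
  arithmetic with \<open>min\<close>.\<close>

lemma le_eval_Box_iff:
  assumes "M \<in> GK" "x \<in> worlds M" "c \<le> 1"
  shows "c \<le> eval M x (\<^bold>\<box> \<phi>) \<longleftrightarrow> (\<forall>y\<in>worlds M. min c (acc M x y) \<le> eval M y \<phi>)"
  using assms by (simp add: cINF_unit(2)[OF GK_D(1)] gimp_unit eval_unit le_gimp_iff del: atLeastAtMost_iff)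

lemma eval_Dia_le_iff:
  assumes "M \<in> GK" "x \<in> worlds M"
  shows "eval M x (\<^bold>\<diamond> \<phi>) \<le> c \<longleftrightarrow> (\<forall>y\<in>worlds M. min (acc M x y) (eval M y \<phi>) \<le> c)"
proof -
  have "min (acc M x y) (eval M y \<phi>) \<in> {0..1}" if "y \<in> worlds M" for y
    using GK_D(2)[OF assms that] eval_unit[OF assms(1) that, of \<phi>] by auto
  then show ?thesis using cSUP_unit(2)[OF GK_D(1)[OF assms(1)]] by auto
qed

lemma min_eval_Box_acc_le:
  assumes "M \<in> GK" "x \<in> worlds M" "y \<in> worlds M"
  shows "min (eval M x (\<^bold>\<box> \<phi>)) (acc M x y) \<le> eval M y \<phi>"
  using le_eval_Box_iff[OF assms(1,2) eval_le_1[OF assms(1,2)]] assms(3) by blast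

lemma min_acc_eval_le_Dia:
  assumes "M \<in> GK" "x \<in> worlds M" "y \<in> worlds M"
  shows "min (acc M x y) (eval M y \<phi>) \<le> eval M x (\<^bold>\<diamond> \<phi>)"
  using eval_Dia_le_iff[OF assms(1,2), of \<phi> "eval M x (\<^bold>\<diamond> \<phi>)"] assms(3) by blast

lemma eval_Imp_eq_1_iff:
  assumes "M \<in> GK" "x \<in> worlds M"
  shows "eval M x (\<phi> \<^bold>\<rightarrow> \<psi>) = 1 \<longleftrightarrow> eval M x \<phi> \<le> eval M x \<psi>"
  using eval_le_1[OF assms] by (simp add: gimp_eq_1_iff)

definition validates :: "('w, 'v) gk_struct \<Rightarrow> 'v fm set \<Rightarrow> bool" where
  "validates M \<S> \<longleftrightarrow> (\<forall>\<phi>\<in>\<S>. \<forall>x\<in>worlds M. eval M x \<phi> = 1)"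

text \<open>The assumptions hold at one world only, but the modal rules need their premise at all
  worlds. Since that premise is derived from no assumptions, an induction hypothesis for arbitrary x
  supplies this.\<close>

lemma soundness:
  assumes "T \<turnstile>\<^bsub>\<S>\<^esub> \<phi>" "M \<in> GK" "validates M \<S>" "x \<in> worlds M" "\<And>\<theta>. \<theta> \<in> T \<Longrightarrow> eval M x \<theta> = 1"
  shows "eval M x \<phi> = 1"
  using assms
proof (induction arbitrary: x rule: derives.induct)
  case (MP T \<S> \<phi> \<psi>)
  have "eval M x (\<phi> \<^bold>\<rightarrow> \<psi>) = 1" "eval M x \<phi> = 1"
    using MP.IH[OF MP.prems(1-3)] MP.prems(4) by auto
  then have "eval M x \<phi> = 1" "eval M x \<phi> \<le> eval M x \<psi>"
    using eval_Imp_eq_1_iff[OF MP.prems(1,3)] by blast+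
  then show ?case using eval_le_1[OF MP.prems(1,3)] by (metis order_antisym)
next
  case (Nec \<S> \<phi> T)
  then have "1 \<le> eval M x (\<^bold>\<box> \<phi>)"
    by (subst le_eval_Box_iff) auto
  then show ?case using eval_le_1[OF Nec.prems(1,3)] by (metis order_antisym)
next
  case (DiaMono \<S> \<phi> \<psi> T)
  have "eval M y \<phi> \<le> eval M y \<psi>" if "y \<in> worlds M" for y
    using DiaMono.IH[OF DiaMono.prems(1,2) that] eval_Imp_eq_1_iff[OF DiaMono.prems(1) that] by blast
  then have "eval M x (\<^bold>\<diamond> \<phi>) \<le> eval M x (\<^bold>\<diamond> \<psi>)"
    using min_acc_eval_le_Dia[OF DiaMono.prems(1,3), of _ \<psi>]
    by (subst eval_Dia_le_iff[OF DiaMono.prems(1,3)]) fastforce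
  then show ?case using eval_Imp_eq_1_iff[OF DiaMono.prems(1,3)] by blast
qed (auto simp: validates_def)

lemma Goedel_ax_valid:
  assumes "M \<in> GK" "x \<in> worlds M" "\<phi> \<in> Goedel_ax"
  shows "eval M x \<phi> = 1"
proof -
  have *: "0 \<le> eval M x \<psi>" "eval M x \<psi> \<le> 1" for \<psi> using eval_unit[OF assms(1,2), of \<psi>] by auto
  from assms(3) show ?thesis
    by cases (use * in \<open>auto simp: gimp_def min_def max_def intro: order_antisym\<close>)
qed

lemma validates_G_BD:
  fixes M :: "('w, 'v) gk_struct"
  assumes M: "M \<in> GK"
  shows "validates M G_BD"
  unfolding validates_def
proof (intro ballI)
  fix \<phi> :: "'v fm" and x assume "\<phi> \<in> G_BD" and x: "x \<in> worlds M"
  note box = min_eval_Box_acc_le[OF M x] and dia = min_acc_eval_le_Dia[OF M x]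
    and le1 = eval_le_1[OF M]
  from \<open>\<phi> \<in> G_BD\<close> show "eval M x \<phi> = 1"
  proof cases
    case 1
    show ?thesis by (rule Goedel_ax_valid[OF M x 1])
  next
    case (2 \<phi> \<psi>)
    have "min (min (eval M x (\<^bold>\<box> (\<phi> \<^bold>\<rightarrow> \<psi>))) (eval M x (\<^bold>\<box> \<phi>))) (acc M x y) \<le> eval M y \<psi>"
      if y: "y \<in> worlds M" for y
    proof -
      have "min (eval M x (\<^bold>\<box> (\<phi> \<^bold>\<rightarrow> \<psi>))) (acc M x y) \<le> eval M y \<phi> \<Rightarrow>\<^sub>G eval M y \<psi>"
        using box[OF y, of "\<phi> \<^bold>\<rightarrow> \<psi>"] by simp
      then have "min (min (eval M x (\<^bold>\<box> (\<phi> \<^bold>\<rightarrow> \<psi>))) (acc M x y)) (eval M y \<phi>) \<le> eval M y \<psi>"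
        using le1[OF x, of "\<^bold>\<box> (\<phi> \<^bold>\<rightarrow> \<psi>)"] by (subst (asm) le_gimp_iff) auto
      then show ?thesis using box[OF y, of \<phi>] by linarith
    qed
    then have "min (eval M x (\<^bold>\<box> (\<phi> \<^bold>\<rightarrow> \<psi>))) (eval M x (\<^bold>\<box> \<phi>)) \<le> eval M x (\<^bold>\<box> \<psi>)"
      using le1[OF x] by (subst le_eval_Box_iff[OF M x]) (auto simp: min_le_iff_disj simp del: eval.simps)
    then show ?thesis unfolding 2 eval_Imp_eq_1_iff[OF M x] unfolding eval.simps(5)
      by (simp only: le_gimp_iff[OF le1[OF x]])
  next
    case (3 \<phi> \<psi>)
    have "min (acc M x y) (eval M y (\<phi> \<^bold>\<or> \<psi>)) \<le> max (eval M x (\<^bold>\<diamond> \<phi>)) (eval M x (\<^bold>\<diamond> \<psi>))"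
      if y: "y \<in> worlds M" for y
      using dia[OF y, of \<phi>] dia[OF y, of \<psi>] unfolding eval.simps(4) by linarith
    then show ?thesis unfolding 3 eval_Imp_eq_1_iff[OF M x]
      by (simp add: eval_Dia_le_iff[OF M x] del: eval.simps(7))
  next
    case 4
    have "eval M x (\<^bold>\<diamond> \<^bold>\<bottom>) \<le> eval M x \<^bold>\<bottom>"
      by (subst eval_Dia_le_iff[OF M x]) auto
    then show ?thesis unfolding 4 eval_Imp_eq_1_iff[OF M x] .
  next
    case (5 \<phi> \<psi>)
    have "min (acc M x y) (eval M y (\<phi> \<^bold>\<rightarrow> \<psi>)) \<le> eval M x (\<^bold>\<box> \<phi>) \<Rightarrow>\<^sub>G eval M x (\<^bold>\<diamond> \<psi>)"
      if y: "y \<in> worlds M" for y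
    proof -
      have "min (eval M y (\<phi> \<^bold>\<rightarrow> \<psi>)) (eval M y \<phi>) \<le> eval M y \<psi>"
        using le_gimp_iff[OF le1[OF y, of "\<phi> \<^bold>\<rightarrow> \<psi>"], of "eval M y \<phi>" "eval M y \<psi>"] by simp
      then have "min (min (acc M x y) (eval M y (\<phi> \<^bold>\<rightarrow> \<psi>))) (eval M x (\<^bold>\<box> \<phi>)) \<le> eval M x (\<^bold>\<diamond> \<psi>)"
        using dia[OF y, of \<psi>] box[OF y, of \<phi>] by linarith
      then show ?thesis using le1[OF y, of "\<phi> \<^bold>\<rightarrow> \<psi>"]
        by (subst le_gimp_iff) (auto simp: min_le_iff_disj)
    qed
    then show ?thesis unfolding 5 eval_Imp_eq_1_iff[OF M x] eval.simps(5)[of M x "\<^bold>\<box> \<phi>"]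
      by (simp add: eval_Dia_le_iff[OF M x] del: eval.simps)
  next
    case (6 \<phi> \<psi>)
    let ?c = "eval M x (\<^bold>\<diamond> \<phi> \<^bold>\<rightarrow> \<^bold>\<box> \<psi>)"
    have c: "min ?c (eval M x (\<^bold>\<diamond> \<phi>)) \<le> eval M x (\<^bold>\<box> \<psi>)"
      using le_gimp_iff[OF le1[OF x, of "\<^bold>\<diamond> \<phi> \<^bold>\<rightarrow> \<^bold>\<box> \<psi>"], of "eval M x (\<^bold>\<diamond> \<phi>)" "eval M x (\<^bold>\<box> \<psi>)"] by simp
    have "min ?c (acc M x y) \<le> eval M y (\<phi> \<^bold>\<rightarrow> \<psi>)" if y: "y \<in> worlds M" for y
    proof -
      have "min (min ?c (acc M x y)) (eval M y \<phi>) \<le> eval M y \<psi>"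
        using c dia[OF y, of \<phi>] box[OF y, of \<psi>] by linarith
      then show ?thesis using le1[OF x, of "\<^bold>\<diamond> \<phi> \<^bold>\<rightarrow> \<^bold>\<box> \<psi>"] unfolding eval.simps(5)[of M y]
        by (subst le_gimp_iff) (auto simp: min_le_iff_disj)
    qed
    then show ?thesis unfolding 6 eval_Imp_eq_1_iff[OF M x]
      by (simp add: le_eval_Box_iff[OF M x le1[OF x]] del: eval.simps)
  qed
qed

lemma validates_GT_BD:
  fixes M :: "('w, 'v) gk_struct"
  assumes "M \<in> Ref"
  shows "validates M GT_BD"
  unfolding validates_def
proof (intro ballI)
  fix \<phi> :: "'v fm" and x assume "\<phi> \<in> GT_BD" and x: "x \<in> worlds M"
  have M: "M \<in> GK" and r: "acc M x x = 1" using assms x by (auto simp: Ref_def)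
  from \<open>\<phi> \<in> GT_BD\<close> show "eval M x \<phi> = 1"
  proof cases
    case 1
    then show ?thesis using validates_G_BD[OF M] x by (auto simp: validates_def)
  next
    case (2 \<phi>)
    show ?thesis unfolding 2 eval_Imp_eq_1_iff[OF M x]
      using min_eval_Box_acc_le[OF M x x, of \<phi>] eval_le_1[OF M x, of "\<^bold>\<box> \<phi>"] r by linarith
  next
    case (3 \<phi>)
    show ?thesis unfolding 3 eval_Imp_eq_1_iff[OF M x]
      using min_acc_eval_le_Dia[OF M x x, of \<phi>] eval_le_1[OF M x, of \<phi>] r by linarith
  qed
qed

lemma validates_GS4_BD:
  fixes M :: "('w, 'v) gk_struct"
  assumes "M \<in> Ref \<inter> Trans"
  shows "validates M GS4_BD"
  unfolding validates_def
proof (intro ballI)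
  fix \<phi> :: "'v fm" and x assume "\<phi> \<in> GS4_BD" and x: "x \<in> worlds M"
  have M: "M \<in> GK" using assms by (auto simp: Ref_def)
  have tr: "min (acc M x y) (acc M y z) \<le> acc M x z" if "y \<in> worlds M" "z \<in> worlds M" for y z
    using assms x that by (auto simp: Trans_def)
  from \<open>\<phi> \<in> GS4_BD\<close> show "eval M x \<phi> = 1"
  proof cases
    case 1
    then show ?thesis using validates_GT_BD[of M] assms x by (auto simp: validates_def)
  next
    case (2 \<phi>)
    have "min (min (eval M x (\<^bold>\<box> \<phi>)) (acc M x y)) (acc M y z) \<le> eval M z \<phi>"
      if y: "y \<in> worlds M" and z: "z \<in> worlds M" for y z
      using min_eval_Box_acc_le[OF M x z, of \<phi>] tr[OF y z] by linarith
    then have "min (eval M x (\<^bold>\<box> \<phi>)) (acc M x y) \<le> eval M y (\<^bold>\<box> \<phi>)" if "y \<in> worlds M" for y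
      using that eval_le_1[OF M x, of "\<^bold>\<box> \<phi>"]
      by (subst le_eval_Box_iff[OF M]) (auto simp: min_le_iff_disj)
    then show ?thesis unfolding 2 eval_Imp_eq_1_iff[OF M x]
      by (simp add: le_eval_Box_iff[OF M x eval_le_1[OF M x]] del: eval.simps)
  next
    case (3 \<phi>)
    have "min (acc M x y) (eval M y (\<^bold>\<diamond> \<phi>)) \<le> eval M x (\<^bold>\<diamond> \<phi>)" if y: "y \<in> worlds M" for y
    proof (cases "acc M x y \<le> eval M x (\<^bold>\<diamond> \<phi>)")
      case False
      have "min (acc M y z) (eval M z \<phi>) \<le> eval M x (\<^bold>\<diamond> \<phi>)" if z: "z \<in> worlds M" for z
        using min_acc_eval_le_Dia[OF M x z, of \<phi>] tr[OF y z] False by linarith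
      then have "eval M y (\<^bold>\<diamond> \<phi>) \<le> eval M x (\<^bold>\<diamond> \<phi>)" by (subst eval_Dia_le_iff[OF M y]) simp
      then show ?thesis by linarith
    qed linarith
    then show ?thesis unfolding 3 eval_Imp_eq_1_iff[OF M x]
      by (simp add: eval_Dia_le_iff[OF M x] del: eval.simps)
  qed
qed

lemma validates_GS5_BD:
  fixes M :: "('w, 'v) gk_struct"
  assumes "M \<in> Ref \<inter> Trans \<inter> Symm"
  shows "validates M GS5_BD"
  unfolding validates_def
proof (intro ballI)
  fix \<phi> :: "'v fm" and x assume "\<phi> \<in> GS5_BD" and x: "x \<in> worlds M"
  have M: "M \<in> GK" using assms by (auto simp: Ref_def)
  have sym: "acc M x y = acc M y x" if "y \<in> worlds M" for y
    using assms x that by (auto simp: Symm_def)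
  from \<open>\<phi> \<in> GS5_BD\<close> show "eval M x \<phi> = 1"
  proof cases
    case 1
    then show ?thesis using validates_GS4_BD[of M] assms x by (auto simp: validates_def)
  next
    case (2 \<phi>)
    have "min (eval M x \<phi>) (acc M x y) \<le> eval M y (\<^bold>\<diamond> \<phi>)" if y: "y \<in> worlds M" for y
      using min_acc_eval_le_Dia[OF M y x, of \<phi>] sym[OF y] by linarith
    then show ?thesis unfolding 2 eval_Imp_eq_1_iff[OF M x]
      by (simp add: le_eval_Box_iff[OF M x eval_le_1[OF M x]] del: eval.simps)
  next
    case (3 \<phi>)
    have "min (acc M x y) (eval M y (\<^bold>\<box> \<phi>)) \<le> eval M x \<phi>" if y: "y \<in> worlds M" for y
      using min_eval_Box_acc_le[OF M y x, of \<phi>] sym[OF y] by linarith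
    then show ?thesis unfolding 3 eval_Imp_eq_1_iff[OF M x]
      by (simp add: eval_Dia_le_iff[OF M x] del: eval.simps)
  qed
qed

subsection \<open>Embedding countable total preorders into the unit interval\<close>

locale bounded_total_preorder =
  fixes R :: "'a \<Rightarrow> 'a \<Rightarrow> bool" and bt tp :: 'a
  assumes trans: "R x y \<Longrightarrow> R y z \<Longrightarrow> R x z"
    and total: "R x y \<or> R y x"
    and bt: "R bt x" and tp: "R x tp" and bt_tp: "\<not> R tp bt"
begin

lemma refl: "R x x"
  using total by blast

end

text \<open>Indices 0 and 1 carry the bounds of the order. For an element equivalent to an earlier
  one, the maximum and the minimum are both the earlier value, so repetitions in the enumeration do
  no harm.\<close>

fun mids :: "('a \<Rightarrow> 'a \<Rightarrow> bool) \<Rightarrow> (nat \<Rightarrow> 'a) \<Rightarrow> nat \<Rightarrow> real" where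
  "mids R e n = (if n = 0 then 0 else if n = 1 then 1 else
     (Max ((\<lambda>i. mids R e i) ` {i\<in>{..<n}. R (e i) (e n)}) +
      Min ((\<lambda>i. mids R e i) ` {i\<in>{..<n}. R (e n) (e i)})) / 2)"

declare mids.simps [simp del]

locale enumerated_preorder = bounded_total_preorder +
  fixes e :: "nat \<Rightarrow> 'a"
  assumes e0: "e 0 = bt" and e1: "e 1 = tp"
begin

abbreviation "f \<equiv> mids R e"

lemma f0: "f 0 = 0" and f1: "f 1 = 1"
  by (simp_all add: mids.simps[of R e 0] mids.simps[of R e 1] mids.simps[of R e "Suc 0"])

lemma f_mid:
  assumes "n \<ge> 2"
  shows "f n = (Max (f ` {i\<in>{..<n}. R (e i) (e n)}) + Min (f ` {i\<in>{..<n}. R (e n) (e i)})) / 2"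
  using assms by (subst mids.simps) auto

lemma f_between:
  assumes n: "n \<ge> 2" and i: "i < n" "R (e i) (e n)" "\<And>k. k < n \<Longrightarrow> R (e k) (e n) \<Longrightarrow> f k \<le> f i"
    and j: "j < n" "R (e n) (e j)" "\<And>k. k < n \<Longrightarrow> R (e n) (e k) \<Longrightarrow> f j \<le> f k"
  shows "f n = (f i + f j) / 2"
proof -
  have "Max (f ` {i\<in>{..<n}. R (e i) (e n)}) = f i"
    by (rule Max_eqI) (use i in auto)
  moreover have "Min (f ` {i\<in>{..<n}. R (e n) (e i)}) = f j"
    by (rule Min_eqI) (use j in auto)
  ultimately show ?thesis using f_mid[OF n] by simp
qed

lemma f_neighbours:
  assumes n: "n \<ge> 2"
  obtains i j where "i < n" "R (e i) (e n)" "\<And>k. k < n \<Longrightarrow> R (e k) (e n) \<Longrightarrow> f k \<le> f i"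
    "j < n" "R (e n) (e j)" "\<And>k. k < n \<Longrightarrow> R (e n) (e k) \<Longrightarrow> f j \<le> f k" "f n = (f i + f j) / 2"
proof -
  let ?L = "{i\<in>{..<n}. R (e i) (e n)}" and ?U = "{i\<in>{..<n}. R (e n) (e i)}"
  have "0 \<in> ?L" "1 \<in> ?U" using n e0 e1 bt tp by auto
  then have "f ` ?L \<noteq> {}" "f ` ?U \<noteq> {}" by blast+
  then have "Max (f ` ?L) \<in> f ` ?L" "Min (f ` ?U) \<in> f ` ?U"
    by (auto intro!: Max_in Min_in simp del: image_is_empty)
  then obtain i j where i: "i \<in> ?L" "f i = Max (f ` ?L)" and j: "j \<in> ?U" "f j = Min (f ` ?U)"
    unfolding image_iff by (elim bexE) simp
  have i_max: "f k \<le> f i" if "k < n" "R (e k) (e n)" for k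
    unfolding i(2) using that by (intro Max_ge) auto
  have j_min: "f j \<le> f k" if "k < n" "R (e n) (e k)" for k
    unfolding j(2) using that by (intro Min_le) auto
  have "i < n" "R (e i) (e n)" "j < n" "R (e n) (e j)" using i(1) j(1) by auto
  then show thesis
    using that[OF _ _ i_max _ _ j_min] f_between[OF n _ _ i_max _ _ j_min] by blast
qed

lemma f_le_iff_aux: "\<forall>i<n. \<forall>j<n. f i \<le> f j \<longleftrightarrow> R (e i) (e j)"
proof (induction n)
  case (Suc n)
  show ?case
  proof (cases "n \<ge> 2")
    case False
    then have "n = 0 \<or> n = 1" by auto
    moreover have "f (Suc 0) = 1" "e (Suc 0) = tp" using f1 e1 by simp_all
    ultimately show ?thesis using f0 e0 bt tp bt_tp refl by (auto simp: less_Suc_eq)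
  next
    case True
    obtain i j where i: "i < n" "R (e i) (e n)" "\<And>k. k < n \<Longrightarrow> R (e k) (e n) \<Longrightarrow> f k \<le> f i"
      and j: "j < n" "R (e n) (e j)" "\<And>k. k < n \<Longrightarrow> R (e n) (e k) \<Longrightarrow> f j \<le> f k"
      and m: "f n = (f i + f j) / 2"
      by (rule f_neighbours[OF True]; rule that; blast)
    have ij: "f i \<le> f j" using Suc.IH i(1,2) j(1,2) trans by blast
    have "f k \<le> f n \<longleftrightarrow> R (e k) (e n)" if k: "k < n" for k
    proof
      assume "R (e k) (e n)" then show "f k \<le> f n" using i(3)[OF k] ij m by auto
    next
      assume kn: "f k \<le> f n"
      show "R (e k) (e n)"
      proof (rule ccontr)
        assume nk: "\<not> R (e k) (e n)"
        then have "f j \<le> f k" using total j(3)[OF k] by blast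
        \<comment> \<open>A midpoint can reach \<open>f j\<close> only if
          \<open>f j \<le> f i\<close>, in which case \<open>e i\<close>, \<open>e n\<close> and
          \<open>e j\<close> form one class; \<open>e k\<close> then lies below that class, contrary
          to \<open>nk\<close>.\<close>
        then have "f j \<le> f i" using kn m by simp
        then have "R (e j) (e i)" using Suc.IH i(1) j(1) by blast
        moreover have "f k \<le> f j" using ij m kn \<open>f j \<le> f i\<close> by simp
        then have "R (e k) (e j)" using Suc.IH k j(1) by blast
        ultimately show False using nk i(2) trans by blast
      qed
    qed
    moreover have "f n \<le> f k \<longleftrightarrow> R (e n) (e k)" if k: "k < n" for k
    proof
      assume "R (e n) (e k)" then show "f n \<le> f k" using j(3)[OF k] ij m by auto
    next
      assume kn: "f n \<le> f k"
      show "R (e n) (e k)"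
      proof (rule ccontr)
        assume nk: "\<not> R (e n) (e k)"
        then have "f k \<le> f i" using total i(3)[OF k] by blast
        then have "f j \<le> f i" using kn m by simp
        then have "R (e j) (e i)" using Suc.IH i(1) j(1) by blast
        moreover have "f i \<le> f k" using ij m kn \<open>f j \<le> f i\<close> by simp
        then have "R (e i) (e k)" using Suc.IH k i(1) by blast
        ultimately show False using nk j(2) trans by blast
      qed
    qed
    ultimately show ?thesis using Suc.IH refl by (auto simp: less_Suc_eq)
  qed
qed simp

lemma f_le_iff: "f i \<le> f j \<longleftrightarrow> R (e i) (e j)"
  using f_le_iff_aux[of "Suc (max i j)"] by auto

lemma f_less_iff: "f i < f j \<longleftrightarrow> \<not> R (e j) (e i)"
  using f_le_iff[of j i] by linarith

text \<open>The first later element that falls strictly between two neighbours is sent to their midpoint.\<close>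

lemma f_halves:
  assumes gap: "\<And>k. k \<le> N \<Longrightarrow> \<not> (f i < f k \<and> f k < f j)" and "i \<le> N" "j \<le> N"
    and "f i < f l" "f l < f j"
  obtains n where "f n = (f i + f j) / 2"
proof -
  define n where "n = (LEAST n. f i < f n \<and> f n < f j)"
  have n: "f i < f n" "f n < f j" using LeastI[of "\<lambda>n. f i < f n \<and> f n < f j" l] assms by (auto simp: n_def)
  have least: "\<not> (f i < f k \<and> f k < f j)" if "k < n" for k
    using not_less_Least[of k "\<lambda>n. f i < f n \<and> f n < f j"] that by (auto simp: n_def)
  have nN: "N < n" using gap n not_le_imp_less by blast
  have "n \<noteq> 0" "n \<noteq> 1"
    using n f_le_iff[of 0 i] f_le_iff[of j 1] e0 e1 bt tp by (metis linorder_not_le)+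
  then have "f n = (f i + f j) / 2"
    using nN assms n least f_le_iff
    by (intro f_between) (force simp: f_le_iff[symmetric] dest: not_le_imp_less)+
  then show thesis by (rule that)
qed

text \<open>If the gaps above \<open>f i\<close> had a positive infimum \<delta>, some gap would be
  smaller than 2\<delta>. The least value above \<open>f i\<close> among the indices up to N is then
  also within 2\<delta>, and the first later element below it lands at the midpoint, leaving a gap
  smaller than \<delta>.\<close>

lemma dense_above:
  assumes lim: "\<And>j. f i < f j \<Longrightarrow> \<exists>l. f i < f l \<and> f l < f j" and i: "f i < f j0" and eps: "\<epsilon> > 0"
  shows "\<exists>j. f i < f j \<and> f j < f i + \<epsilon>"
proof (rule ccontr)
  assume neg: "\<not> ?thesis"
  define \<delta> where "\<delta> = (INF j\<in>{j. f i < f j}. f j - f i)"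
  have bdd: "bdd_below ((\<lambda>j. f j - f i) ` {j. f i < f j})" by (rule bdd_belowI[of _ 0]) auto
  have "\<epsilon> \<le> \<delta>" unfolding \<delta>_def using i neg by (intro cINF_greatest) force+
  then have "\<delta> < 2 * \<delta>" using eps by simp
  then obtain j where j: "f i < f j" "f j - f i < 2 * \<delta>"
    using cInf_lessD[of "(\<lambda>j. f j - f i) ` {j. f i < f j}" "2 * \<delta>"] i unfolding \<delta>_def by auto
  define N where "N = max i j"
  define A where "A = {k. k \<le> N \<and> f i < f k}"
  have "finite A" "j \<in> A" using j by (auto simp: A_def N_def)
  then have "Min (f ` A) \<in> f ` A" by (intro Min_in) auto
  then obtain k where "k \<in> A" "f k = Min (f ` A)" by auto
  then have k: "k \<in> A" "\<And>l. l \<in> A \<Longrightarrow> f k \<le> f l"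
    using \<open>finite A\<close> by simp_all
  obtain l where l: "f i < f l" "f l < f k" using lim k(1) by (auto simp: A_def)
  have gap: "\<not> (f i < f k' \<and> f k' < f k)" if "k' \<le> N" for k'
    using k(2)[of k'] that by (auto simp: A_def)
  obtain n where n: "f n = (f i + f k) / 2"
    using f_halves[of N i k l] gap l k(1) by (auto simp: A_def N_def)
  have "f i < f n" using l n by simp
  then have "\<delta> \<le> f n - f i" unfolding \<delta>_def using bdd by (intro cINF_lower) auto
  moreover have "f k \<le> f j" using k(2) \<open>j \<in> A\<close> by blast
  ultimately show False using n j(2) by (simp add: field_simps)
qed

lemma dense_below:
  assumes lim: "\<And>j. f j < f i \<Longrightarrow> \<exists>l. f j < f l \<and> f l < f i" and i: "f j0 < f i" and eps: "\<epsilon> > 0"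
  shows "\<exists>j. f j < f i \<and> f i - \<epsilon> < f j"
proof (rule ccontr)
  assume neg: "\<not> ?thesis"
  define \<delta> where "\<delta> = (INF j\<in>{j. f j < f i}. f i - f j)"
  have bdd: "bdd_below ((\<lambda>j. f i - f j) ` {j. f j < f i})" by (rule bdd_belowI[of _ 0]) auto
  have "\<epsilon> \<le> \<delta>" unfolding \<delta>_def using i neg by (intro cINF_greatest) force+
  then have "\<delta> < 2 * \<delta>" using eps by simp
  then obtain j where j: "f j < f i" "f i - f j < 2 * \<delta>"
    using cInf_lessD[of "(\<lambda>j. f i - f j) ` {j. f j < f i}" "2 * \<delta>"] i unfolding \<delta>_def by auto
  define N where "N = max i j"
  define A where "A = {k. k \<le> N \<and> f k < f i}"
  have "finite A" "j \<in> A" using j by (auto simp: A_def N_def)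
  then have "Max (f ` A) \<in> f ` A" by (intro Max_in) auto
  then obtain k where "k \<in> A" "f k = Max (f ` A)" by auto
  then have k: "k \<in> A" "\<And>l. l \<in> A \<Longrightarrow> f l \<le> f k"
    using \<open>finite A\<close> by simp_all
  obtain l where l: "f k < f l" "f l < f i" using lim k(1) by (auto simp: A_def)
  have gap: "\<not> (f k < f k' \<and> f k' < f i)" if "k' \<le> N" for k'
    using k(2)[of k'] that by (auto simp: A_def)
  obtain n where n: "f n = (f k + f i) / 2"
    using f_halves[of N k i l] gap l k(1) by (auto simp: A_def N_def)
  have "f n < f i" using l n by simp
  then have "\<delta> \<le> f i - f n" unfolding \<delta>_def using bdd by (intro cINF_lower) auto
  moreover have "f j \<le> f k" using k(2) \<open>j \<in> A\<close> by blast
  ultimately show False using n j(2) by (simp add: field_simps)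
qed

end

text \<open>An arbitrary embedding of a countable order into [0,1] may jump at a point without
  immediate successor or predecessor. Midpoints exclude such jumps, which is what the last two
  clauses express.\<close>

lemma (in bounded_total_preorder) embedding_exists:
  assumes "countable (UNIV :: 'a set)"
  shows "\<exists>g :: 'a \<Rightarrow> real. (\<forall>x y. g x \<le> g y \<longleftrightarrow> R x y) \<and> g bt = 0 \<and> g tp = 1 \<and>
    (\<forall>x. (\<forall>y. \<not> R y x \<longrightarrow> (\<exists>z. \<not> R z x \<and> \<not> R y z)) \<longrightarrow> \<not> R tp x \<longrightarrow>
       (\<forall>\<epsilon>>0. \<exists>y. \<not> R y x \<and> g y < g x + \<epsilon>)) \<and>
    (\<forall>x. (\<forall>y. \<not> R x y \<longrightarrow> (\<exists>z. \<not> R x z \<and> \<not> R z y)) \<longrightarrow> \<not> R x bt \<longrightarrow>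
       (\<forall>\<epsilon>>0. \<exists>y. \<not> R x y \<and> g x - \<epsilon> < g y))"
proof -
  \<comment> \<open>The shift by 2 frees the first two indices for the bounds, which the enumeration
    lists a second time.\<close>
  define e where "e n = (if n = 0 then bt else if n = 1 then tp else from_nat_into (UNIV :: 'a set) (n - 2))" for n
  interpret enumerated_preorder R bt tp e
    by unfold_locales (simp_all add: e_def)
  have "\<exists>n. e n = x" for x
  proof -
    obtain n where "from_nat_into UNIV n = x" using from_nat_into_surj[OF assms] by blast
    then have "e (n + 2) = x" by (simp add: e_def)
    then show ?thesis ..
  qed
  then obtain h where h: "\<And>x. e (h x) = x" by metis
  let ?g = "\<lambda>x. f (h x)"
  have le: "?g x \<le> ?g y \<longleftrightarrow> R x y" for x y by (simp add: f_le_iff h)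
  have less: "?g x < ?g y \<longleftrightarrow> \<not> R y x" for x y by (simp add: f_less_iff h)
  have fe: "f i = ?g (e i)" for i
    using f_le_iff h refl by (simp add: order_eq_iff)
  have "?g bt = 0" "?g tp = 1" using fe[of 0] fe[of 1] f0 f1 e0 e1 by simp_all
  moreover have "\<exists>y. \<not> R y x \<and> ?g y < ?g x + \<epsilon>"
    if "\<forall>y. \<not> R y x \<longrightarrow> (\<exists>z. \<not> R z x \<and> \<not> R y z)" "\<not> R tp x" "\<epsilon> > 0" for x \<epsilon>
    using dense_above[of "h x" "h tp" \<epsilon>] that less h f_less_iff by (metis fe)
  moreover have "\<exists>y. \<not> R x y \<and> ?g x - \<epsilon> < ?g y"
    if "\<forall>y. \<not> R x y \<longrightarrow> (\<exists>z. \<not> R x z \<and> \<not> R z y)" "\<not> R x bt" "\<epsilon> > 0" for x \<epsilon>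
    using dense_below[of "h x" "h bt" \<epsilon>] that less h f_less_iff by (metis fe)
  ultimately show ?thesis using le by (intro exI[of _ ?g]) blast
qed

subsection \<open>Prime theories\<close>

lemma derives_mono:
  assumes "T \<turnstile>\<^bsub>\<S>\<^esub> \<phi>" "T \<subseteq> T'"
  shows "T' \<turnstile>\<^bsub>\<S>\<^esub> \<phi>"
  using assms by (induction arbitrary: T' rule: derives.induct) (auto intro: derives.intros)

text \<open>A derivation uses finitely many assumptions, and these lie together in one member of a
  chain. Non-emptiness of C covers the rules that use none.\<close>

lemma derives_union_chain:
  assumes "T \<turnstile>\<^bsub>\<S>\<^esub> \<phi>" "T \<subseteq> \<Union>C" "C \<noteq> {}" "\<And>X Y. X \<in> C \<Longrightarrow> Y \<in> C \<Longrightarrow> X \<subseteq> Y \<or> Y \<subseteq> X"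
  shows "\<exists>X\<in>C. X \<turnstile>\<^bsub>\<S>\<^esub> \<phi>"
  using assms
proof (induction rule: derives.induct)
  case (MP T \<S> \<phi> \<psi>)
  then obtain X Y where "X \<in> C" "Y \<in> C" "X \<turnstile>\<^bsub>\<S>\<^esub> \<phi> \<^bold>\<rightarrow> \<psi>" "Y \<turnstile>\<^bsub>\<S>\<^esub> \<phi>" by blast
  moreover from this have "X \<subseteq> Y \<or> Y \<subseteq> X" using MP.prems(3) by blast
  ultimately show ?case by (metis derives.MP derives_mono)
next
  case (Assm \<phi> T \<S>)
  then show ?case by (blast intro: derives.Assm)
qed (auto intro: derives.intros)

locale calculus =
  fixes \<S> :: "'v fm set"
  assumes GT_BD_subset: "GT_BD \<subseteq> \<S>"
begin

lemma G_BD_ax: "\<phi> \<in> G_BD \<Longrightarrow> T \<turnstile>\<^bsub>\<S>\<^esub> \<phi>"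
  using GT_BD_subset by (auto intro: derives.Ax GT_BD.intros)

lemma Goedel_ax: "\<phi> \<in> Goedel_ax \<Longrightarrow> T \<turnstile>\<^bsub>\<S>\<^esub> \<phi>"
  by (auto intro: G_BD_ax G_BD.intros)

lemma weaken: "T \<turnstile>\<^bsub>\<S>\<^esub> \<psi> \<Longrightarrow> T \<turnstile>\<^bsub>\<S>\<^esub> \<phi> \<^bold>\<rightarrow> \<psi>"
  by (rule derives.MP[OF Goedel_ax]) (rule Goedel_ax.intros)

lemma frege: "T \<turnstile>\<^bsub>\<S>\<^esub> \<phi> \<^bold>\<rightarrow> \<psi> \<^bold>\<rightarrow> \<chi> \<Longrightarrow> T \<turnstile>\<^bsub>\<S>\<^esub> \<phi> \<^bold>\<rightarrow> \<psi> \<Longrightarrow> T \<turnstile>\<^bsub>\<S>\<^esub> \<phi> \<^bold>\<rightarrow> \<chi>"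
  by (rule derives.MP[OF derives.MP[OF Goedel_ax]]) (rule Goedel_ax.intros)

lemma imp_refl: "T \<turnstile>\<^bsub>\<S>\<^esub> \<phi> \<^bold>\<rightarrow> \<phi>"
  by (rule frege[of _ _ "\<phi> \<^bold>\<rightarrow> \<phi>"]) (rule Goedel_ax, rule Goedel_ax.intros)+

lemma imp_trans: "T \<turnstile>\<^bsub>\<S>\<^esub> \<phi> \<^bold>\<rightarrow> \<psi> \<Longrightarrow> T \<turnstile>\<^bsub>\<S>\<^esub> \<psi> \<^bold>\<rightarrow> \<chi> \<Longrightarrow> T \<turnstile>\<^bsub>\<S>\<^esub> \<phi> \<^bold>\<rightarrow> \<chi>"
  by (blast intro: frege weaken)

lemma disj_elim: "T \<turnstile>\<^bsub>\<S>\<^esub> \<phi> \<^bold>\<rightarrow> \<chi> \<Longrightarrow> T \<turnstile>\<^bsub>\<S>\<^esub> \<psi> \<^bold>\<rightarrow> \<chi> \<Longrightarrow> T \<turnstile>\<^bsub>\<S>\<^esub> \<phi> \<^bold>\<or> \<psi> \<^bold>\<rightarrow> \<chi>"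
  by (rule derives.MP[OF derives.MP[OF Goedel_ax]]) (rule Goedel_ax.intros)

text \<open>The modal rules are no obstacle: their premises are theorems, so their conclusions hold
  over T already and only need weakening.\<close>

lemma deduction:
  assumes "insert \<phi> T \<turnstile>\<^bsub>\<S>\<^esub> \<psi>"
  shows "T \<turnstile>\<^bsub>\<S>\<^esub> \<phi> \<^bold>\<rightarrow> \<psi>"
proof -
  have "T \<turnstile>\<^bsub>S\<^esub> \<phi> \<^bold>\<rightarrow> \<psi>" if "U \<turnstile>\<^bsub>S\<^esub> \<psi>" "U = insert \<phi> T" "S = \<S>" for U S \<psi>
    using that
    by (induction rule: derives.induct) (auto intro: imp_refl weaken frege derives.intros)
  then show ?thesis using assms by blast
qed

text \<open>The modal rules need no clause of their own, because their conclusions are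
  theorems.\<close>

definition closed :: "'v fm set \<Rightarrow> bool" where
  "closed X \<longleftrightarrow> (\<forall>\<phi>. {} \<turnstile>\<^bsub>\<S>\<^esub> \<phi> \<longrightarrow> \<phi> \<in> X) \<and> (\<forall>\<phi> \<psi>. \<phi> \<^bold>\<rightarrow> \<psi> \<in> X \<longrightarrow> \<phi> \<in> X \<longrightarrow> \<psi> \<in> X)"

definition prime :: "'v fm set \<Rightarrow> bool" where
  "prime P \<longleftrightarrow> closed P \<and> \<^bold>\<bottom> \<notin> P \<and> (\<forall>\<phi> \<psi>. \<phi> \<^bold>\<or> \<psi> \<in> P \<longrightarrow> \<phi> \<in> P \<or> \<psi> \<in> P)"

lemma closed_derives:
  assumes "closed X" "X \<turnstile>\<^bsub>\<S>\<^esub> \<phi>"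
  shows "\<phi> \<in> X"
proof -
  have "\<phi> \<in> X" if "U \<turnstile>\<^bsub>S\<^esub> \<phi>" "U = X" "S = \<S>" for U S \<phi>
    using that assms(1)
    by (induction rule: derives.induct) (auto simp: closed_def intro: derives.intros)
  then show ?thesis using assms by blast
qed

text \<open>Avoiding an ideal \<open>D\<close> of formulas, and not just one formula, is what lets a witnessing world
  respect the strict inequalities among the values of the world it witnesses for.\<close>

lemma prime_extension:
  assumes T: "\<And>\<delta>. \<delta> \<in> D \<Longrightarrow> \<not> T \<turnstile>\<^bsub>\<S>\<^esub> \<delta>" and D: "\<And>\<delta> \<epsilon>. \<delta> \<in> D \<Longrightarrow> \<epsilon> \<in> D \<Longrightarrow> \<delta> \<^bold>\<or> \<epsilon> \<in> D" and bot: "\<^bold>\<bottom> \<in> D"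
  obtains P where "prime P" "T \<subseteq> P" "P \<inter> D = {}"
proof -
  let ?A = "{X. T \<subseteq> X \<and> (\<forall>\<delta>\<in>D. \<not> X \<turnstile>\<^bsub>\<S>\<^esub> \<delta>)}"
  have "\<exists>P\<in>?A. \<forall>X\<in>?A. P \<subseteq> X \<longrightarrow> X = P"
  proof (rule subset_Zorn_nonempty)
    show "?A \<noteq> {}" using T by blast
  next
    fix C assume C: "C \<noteq> {}" "subset.chain ?A C"
    have lin: "X \<subseteq> Y \<or> Y \<subseteq> X" if "X \<in> C" "Y \<in> C" for X Y
      using C(2) that by (auto simp: subset_chain_def)
    have "\<not> \<Union>C \<turnstile>\<^bsub>\<S>\<^esub> \<delta>" if "\<delta> \<in> D" for \<delta>
    proof
      assume "\<Union>C \<turnstile>\<^bsub>\<S>\<^esub> \<delta>"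
      then obtain X where "X \<in> C" "X \<turnstile>\<^bsub>\<S>\<^esub> \<delta>"
        using derives_union_chain[OF _ subset_refl C(1) lin] by blast
      then show False using C(2) that by (auto simp: subset_chain_def)
    qed
    then show "\<Union>C \<in> ?A" using C unfolding subset_chain_def by blast
  qed
  then obtain P where P: "T \<subseteq> P" "\<And>\<delta>. \<delta> \<in> D \<Longrightarrow> \<not> P \<turnstile>\<^bsub>\<S>\<^esub> \<delta>"
    and max: "\<And>X. T \<subseteq> X \<Longrightarrow> (\<And>\<delta>. \<delta> \<in> D \<Longrightarrow> \<not> X \<turnstile>\<^bsub>\<S>\<^esub> \<delta>) \<Longrightarrow> P \<subseteq> X \<Longrightarrow> X = P"
    by auto
  \<comment> \<open>By maximality, adding a formula outside P makes some member of D
    derivable.\<close>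
  have excluded: "\<exists>\<delta>\<in>D. P \<turnstile>\<^bsub>\<S>\<^esub> \<phi> \<^bold>\<rightarrow> \<delta>" if "\<phi> \<notin> P" for \<phi>
  proof -
    have "\<exists>\<delta>\<in>D. insert \<phi> P \<turnstile>\<^bsub>\<S>\<^esub> \<delta>" using max[of "insert \<phi> P"] that P(1) by blast
    then show ?thesis using deduction by blast
  qed
  have in_P: "\<phi> \<in> P" if "P \<turnstile>\<^bsub>\<S>\<^esub> \<phi>" for \<phi>
    using excluded[of \<phi>] that P(2) derives.MP by blast
  have "closed P" unfolding closed_def
    using in_P derives_mono[OF _ empty_subsetI] by (meson derives.MP derives.Assm)
  moreover have "\<^bold>\<bottom> \<notin> P" using P(2)[OF bot] derives.Assm by blast
  moreover have "\<phi> \<in> P \<or> \<psi> \<in> P" if "\<phi> \<^bold>\<or> \<psi> \<in> P" for \<phi> \<psi>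
  proof (rule ccontr)
    assume "\<not> (\<phi> \<in> P \<or> \<psi> \<in> P)"
    then obtain \<delta> \<epsilon> where d: "\<delta> \<in> D" "\<epsilon> \<in> D" "P \<turnstile>\<^bsub>\<S>\<^esub> \<phi> \<^bold>\<rightarrow> \<delta>" "P \<turnstile>\<^bsub>\<S>\<^esub> \<psi> \<^bold>\<rightarrow> \<epsilon>"
      using excluded by blast
    have "P \<turnstile>\<^bsub>\<S>\<^esub> \<delta> \<^bold>\<rightarrow> \<delta> \<^bold>\<or> \<epsilon>" "P \<turnstile>\<^bsub>\<S>\<^esub> \<epsilon> \<^bold>\<rightarrow> \<delta> \<^bold>\<or> \<epsilon>" by (auto intro: Goedel_ax Goedel_ax.intros)
    then have "P \<turnstile>\<^bsub>\<S>\<^esub> \<phi> \<^bold>\<or> \<psi> \<^bold>\<rightarrow> \<delta> \<^bold>\<or> \<epsilon>" using d(3,4) by (blast intro: disj_elim imp_trans)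
    then have "P \<turnstile>\<^bsub>\<S>\<^esub> \<delta> \<^bold>\<or> \<epsilon>" using that derives.MP derives.Assm by blast
    then show False using P(2) D d(1,2) by blast
  qed
  moreover have "P \<inter> D = {}" using P(2) derives.Assm by blast
  ultimately show thesis using that[of P] P(1) by (auto simp: prime_def)
qed

lemma prime_extension_single:
  assumes "\<not> T \<turnstile>\<^bsub>\<S>\<^esub> \<phi>"
  obtains P where "prime P" "T \<subseteq> P" "\<phi> \<notin> P"
\<comment> \<open>The ideal to be avoided is the principal one generated by \<phi>.\<close>
proof (rule prime_extension[of "{\<delta>. {} \<turnstile>\<^bsub>\<S>\<^esub> \<delta> \<^bold>\<rightarrow> \<phi>}" T])
  show "\<not> T \<turnstile>\<^bsub>\<S>\<^esub> \<delta>" if "\<delta> \<in> {\<delta>. {} \<turnstile>\<^bsub>\<S>\<^esub> \<delta> \<^bold>\<rightarrow> \<phi>}" for \<delta>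
    using that assms derives_mono[of "{}" _ _ T] derives.MP by blast
qed (use that in \<open>auto intro: disj_elim Goedel_ax Goedel_ax.intros imp_refl\<close>)

text \<open>Lets propositional theorems be checked by computing in the linear order of an arbitrary
  prime theory instead of by a Hilbert-style derivation.\<close>

lemma derives_iff_prime: "T \<turnstile>\<^bsub>\<S>\<^esub> \<phi> \<longleftrightarrow> (\<forall>P. prime P \<longrightarrow> T \<subseteq> P \<longrightarrow> \<phi> \<in> P)"
proof
  show "\<forall>P. prime P \<longrightarrow> T \<subseteq> P \<longrightarrow> \<phi> \<in> P" if "T \<turnstile>\<^bsub>\<S>\<^esub> \<phi>"
    using derives_mono[OF that] closed_derives unfolding prime_def by blast
qed (metis prime_extension_single)

end

section \<open>The linear preorder of a prime theory and its modal witnesses\<close>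

locale prime_theory = calculus +
  fixes P :: "'a fm set"
  assumes prime: "prime P"
begin

abbreviation le :: "'a fm \<Rightarrow> 'a fm \<Rightarrow> bool" (infix \<open>\<preceq>\<close> 50) where
  "\<phi> \<preceq> \<psi> \<equiv> \<phi> \<^bold>\<rightarrow> \<psi> \<in> P"

lemma theorem_in: "{} \<turnstile>\<^bsub>\<S>\<^esub> \<phi> \<Longrightarrow> \<phi> \<in> P"
  and mp: "\<phi> \<preceq> \<psi> \<Longrightarrow> \<phi> \<in> P \<Longrightarrow> \<psi> \<in> P"
  and bot_notin: "\<^bold>\<bottom> \<notin> P"
  and disj_cases: "\<phi> \<^bold>\<or> \<psi> \<in> P \<Longrightarrow> \<phi> \<in> P \<or> \<psi> \<in> P"
  using prime by (auto simp: prime_def closed_def)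

lemma in_if_derives: "P \<turnstile>\<^bsub>\<S>\<^esub> \<phi> \<Longrightarrow> \<phi> \<in> P"
  using prime closed_derives by (auto simp: prime_def)

lemma Goedel_ax_in: "\<phi> \<in> Goedel_ax \<Longrightarrow> \<phi> \<in> P"
  by (blast intro: theorem_in Goedel_ax)

lemma G_BD_in: "\<phi> \<in> G_BD \<Longrightarrow> \<phi> \<in> P"
  by (blast intro: theorem_in G_BD_ax)

lemma le_refl: "\<phi> \<preceq> \<phi>"
  by (blast intro: theorem_in imp_refl)

lemma le_trans: "\<phi> \<preceq> \<psi> \<Longrightarrow> \<psi> \<preceq> \<chi> \<Longrightarrow> \<phi> \<preceq> \<chi>"
  by (blast intro: in_if_derives imp_trans derives.Assm)

lemma le_total: "\<phi> \<preceq> \<psi> \<or> \<psi> \<preceq> \<phi>"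
  by (rule disj_cases[OF Goedel_ax_in[OF Goedel_ax.intros(10)]])

lemma bot_le: "\<^bold>\<bottom> \<preceq> \<phi>"
  by (blast intro: Goedel_ax_in Goedel_ax.intros)

lemma le_if_in: "\<psi> \<in> P \<Longrightarrow> \<phi> \<preceq> \<psi>"
  by (blast intro: in_if_derives weaken derives.Assm)

lemma le_and_iff: "\<chi> \<preceq> \<phi> \<^bold>\<and> \<psi> \<longleftrightarrow> \<chi> \<preceq> \<phi> \<and> \<chi> \<preceq> \<psi>"
proof
  assume "\<chi> \<preceq> \<phi> \<and> \<chi> \<preceq> \<psi>"
  moreover have "\<chi> \<preceq> \<phi> \<^bold>\<rightarrow> \<psi> \<^bold>\<rightarrow> \<phi> \<^bold>\<and> \<psi>" by (blast intro: le_if_in Goedel_ax_in Goedel_ax.intros)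
  ultimately show "\<chi> \<preceq> \<phi> \<^bold>\<and> \<psi>" by (meson in_if_derives frege derives.Assm)
qed (blast intro: le_trans Goedel_ax_in Goedel_ax.intros)

lemma or_le_iff: "\<phi> \<^bold>\<or> \<psi> \<preceq> \<chi> \<longleftrightarrow> \<phi> \<preceq> \<chi> \<and> \<psi> \<preceq> \<chi>"
proof
  assume "\<phi> \<preceq> \<chi> \<and> \<psi> \<preceq> \<chi>"
  then show "\<phi> \<^bold>\<or> \<psi> \<preceq> \<chi>" by (blast intro: in_if_derives disj_elim derives.Assm)
qed (blast intro: le_trans Goedel_ax_in Goedel_ax.intros)

lemma and_le_iff: "\<phi> \<^bold>\<and> \<psi> \<preceq> \<chi> \<longleftrightarrow> \<phi> \<preceq> \<chi> \<or> \<psi> \<preceq> \<chi>"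
proof
  assume "\<phi> \<^bold>\<and> \<psi> \<preceq> \<chi>"
  moreover have "\<phi> \<preceq> \<phi> \<^bold>\<and> \<psi> \<or> \<psi> \<preceq> \<phi> \<^bold>\<and> \<psi>" using le_total le_refl by (auto simp: le_and_iff)
  ultimately show "\<phi> \<preceq> \<chi> \<or> \<psi> \<preceq> \<chi>" using le_trans by blast
qed (blast intro: le_trans Goedel_ax_in Goedel_ax.intros)

lemma le_or_iff: "\<chi> \<preceq> \<phi> \<^bold>\<or> \<psi> \<longleftrightarrow> \<chi> \<preceq> \<phi> \<or> \<chi> \<preceq> \<psi>"
proof
  assume "\<chi> \<preceq> \<phi> \<^bold>\<or> \<psi>"
  moreover have "\<phi> \<^bold>\<or> \<psi> \<preceq> \<phi> \<or> \<phi> \<^bold>\<or> \<psi> \<preceq> \<psi>" using le_total le_refl by (auto simp: or_le_iff)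
  ultimately show "\<chi> \<preceq> \<phi> \<or> \<chi> \<preceq> \<psi>" using le_trans by blast
qed (blast intro: le_trans Goedel_ax_in Goedel_ax.intros)

text \<open>Linearity compares \<phi> with \<phi> \<rightarrow> \<psi>, and contraction gives one
  alternative in each of the two cases.\<close>

lemma imp_le: "\<phi> \<preceq> \<psi> \<or> \<phi> \<^bold>\<rightarrow> \<psi> \<preceq> \<psi>"
proof -
  have "\<phi> \<preceq> \<phi> \<^bold>\<rightarrow> \<psi> \<or> \<phi> \<^bold>\<rightarrow> \<psi> \<preceq> \<phi>" by (rule le_total)
  moreover have "\<phi> \<preceq> \<psi>" if "\<phi> \<preceq> \<phi> \<^bold>\<rightarrow> \<psi>"
    using that by (blast intro: in_if_derives frege derives.Assm imp_refl)
  moreover have "\<phi> \<^bold>\<rightarrow> \<psi> \<preceq> \<psi>" if "\<phi> \<^bold>\<rightarrow> \<psi> \<preceq> \<phi>"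
    using that by (blast intro: in_if_derives frege derives.Assm imp_refl)
  ultimately show ?thesis by blast
qed

lemma le_imp_iff: "\<chi> \<preceq> \<phi> \<^bold>\<rightarrow> \<psi> \<longleftrightarrow> \<phi> \<preceq> \<psi> \<or> \<chi> \<preceq> \<psi>"
  using imp_le le_trans le_if_in Goedel_ax_in[OF Goedel_ax.intros(1)] by blast

lemma Box_mono: "{} \<turnstile>\<^bsub>\<S>\<^esub> \<phi> \<^bold>\<rightarrow> \<psi> \<Longrightarrow> \<^bold>\<box> \<phi> \<preceq> \<^bold>\<box> \<psi>"
  by (rule theorem_in, rule derives.MP[OF G_BD_ax], rule G_BD.intros(2), rule derives.Nec)

lemma Dia_mono: "{} \<turnstile>\<^bsub>\<S>\<^esub> \<phi> \<^bold>\<rightarrow> \<psi> \<Longrightarrow> \<^bold>\<diamond> \<phi> \<preceq> \<^bold>\<diamond> \<psi>"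
  by (rule theorem_in, rule derives.DiaMono)

lemma Box_imp: "\<^bold>\<box> \<phi> \<preceq> \<^bold>\<box> \<psi> \<or> \<^bold>\<box> (\<phi> \<^bold>\<rightarrow> \<psi>) \<preceq> \<^bold>\<box> \<psi>"
  using G_BD_in[OF G_BD.intros(2)] by (simp add: le_imp_iff)

lemma Dia_imp: "\<^bold>\<box> \<phi> \<preceq> \<^bold>\<diamond> \<psi> \<or> \<^bold>\<diamond> (\<phi> \<^bold>\<rightarrow> \<psi>) \<preceq> \<^bold>\<diamond> \<psi>"
  using G_BD_in[OF G_BD.intros(5)] by (simp add: le_imp_iff)

lemma Box_imp_in: "\<^bold>\<diamond> \<phi> \<preceq> \<^bold>\<box> \<psi> \<Longrightarrow> \<^bold>\<box> (\<phi> \<^bold>\<rightarrow> \<psi>) \<in> P"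
  by (rule mp[OF G_BD_in[OF G_BD.intros(6)]])

lemma Dia_or: "\<^bold>\<diamond> (\<phi> \<^bold>\<or> \<psi>) \<preceq> \<^bold>\<diamond> \<phi> \<or> \<^bold>\<diamond> (\<phi> \<^bold>\<or> \<psi>) \<preceq> \<^bold>\<diamond> \<psi>"
  using G_BD_in[OF G_BD.intros(3)] by (simp add: le_or_iff)

lemma Dia_bot_le: "\<^bold>\<diamond> \<^bold>\<bottom> \<preceq> \<phi>"
  using G_BD_in[OF G_BD.intros(4)] bot_le le_trans by blast

lemma Box_theorem_in: "{} \<turnstile>\<^bsub>\<S>\<^esub> \<phi> \<Longrightarrow> \<^bold>\<box> \<phi> \<in> P"
  by (blast intro: theorem_in derives.Nec)

text \<open>Strictness matters here: Q makes true whatever is boxed strictly above \<box>\<psi>,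
  while formulas whose diamond is at most \<box>\<psi>, and \<psi> itself, are kept out.\<close>

lemma Box_witness:
  assumes "\<^bold>\<box> \<psi> \<notin> P"
  obtains Q where "prime Q" "\<psi> \<notin> Q" "\<And>\<chi>. \<not> \<^bold>\<box> \<chi> \<preceq> \<^bold>\<box> \<psi> \<Longrightarrow> \<chi> \<in> Q" "\<And>\<delta>. \<^bold>\<diamond> \<delta> \<preceq> \<^bold>\<box> \<psi> \<Longrightarrow> \<delta> \<notin> Q"
proof -
  define \<Gamma> where "\<Gamma> = {\<chi>. \<not> \<^bold>\<box> \<chi> \<preceq> \<^bold>\<box> \<psi>}"
  \<comment> \<open>The ideal generated by \<psi> and the \<delta> to be omitted; those \<delta> are
    closed under disjunction by \<open>Dia_or\<close>.\<close>
  define D where "D = {\<epsilon>. \<exists>\<delta>. \<^bold>\<diamond> \<delta> \<preceq> \<^bold>\<box> \<psi> \<and> {} \<turnstile>\<^bsub>\<S>\<^esub> \<epsilon> \<^bold>\<rightarrow> \<delta> \<^bold>\<or> \<psi>}"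
  have "closed \<Gamma>"
    unfolding closed_def \<Gamma>_def
    using Box_theorem_in assms mp Box_imp le_trans by blast
  then have "\<not> \<Gamma> \<turnstile>\<^bsub>\<S>\<^esub> \<epsilon>" if \<epsilon>: "\<epsilon> \<in> D" for \<epsilon>
  proof -
    obtain \<delta> where d: "\<^bold>\<diamond> \<delta> \<preceq> \<^bold>\<box> \<psi>" "{} \<turnstile>\<^bsub>\<S>\<^esub> \<epsilon> \<^bold>\<rightarrow> \<delta> \<^bold>\<or> \<psi>" using \<epsilon> by (auto simp: D_def)
    \<comment> \<open>The K axiom does not apply to a boxed disjunction \<delta> \<or> \<psi>, but
      it does to the weaker formula (\<delta> \<rightarrow> \<psi>) \<rightarrow> \<psi>.\<close>
    have "{} \<turnstile>\<^bsub>\<S>\<^esub> \<epsilon> \<^bold>\<rightarrow> (\<delta> \<^bold>\<rightarrow> \<psi>) \<^bold>\<rightarrow> \<psi>"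
      unfolding derives_iff_prime
    proof (intro allI impI)
      fix Q assume "prime Q"
      then interpret Q: prime_theory \<S> Q by unfold_locales
      show "Q.le \<epsilon> ((\<delta> \<^bold>\<rightarrow> \<psi>) \<^bold>\<rightarrow> \<psi>)"
        using Q.theorem_in[OF d(2)] Q.le_total Q.le_trans Q.imp_le unfolding Q.le_imp_iff Q.le_or_iff 
        using Q.mp Q.le_if_in by blast
    qed
    then have "\<^bold>\<box> \<epsilon> \<preceq> \<^bold>\<box> ((\<delta> \<^bold>\<rightarrow> \<psi>) \<^bold>\<rightarrow> \<psi>)" by (rule Box_mono)
    \<comment> \<open>As \<diamond>\<delta> \<le> \<box>\<psi>, the axiom linking diamond and box
      makes \<box>(\<delta> \<rightarrow> \<psi>) true, hence strictly above \<box>\<psi>. The K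
      axiom must then bound \<box>\<epsilon> by \<box>\<psi>.\<close>
    moreover have "\<not> \<^bold>\<box> (\<delta> \<^bold>\<rightarrow> \<psi>) \<preceq> \<^bold>\<box> \<psi>" using Box_imp_in[OF d(1)] mp assms by blast
    ultimately have "\<^bold>\<box> \<epsilon> \<preceq> \<^bold>\<box> \<psi>" using Box_imp le_trans by blast
    then show ?thesis using closed_derives[OF \<open>closed \<Gamma>\<close>] by (auto simp: \<Gamma>_def)
  qed
  moreover have "\<epsilon>1 \<^bold>\<or> \<epsilon>2 \<in> D" if \<epsilon>: "\<epsilon>1 \<in> D" "\<epsilon>2 \<in> D" for \<epsilon>1 \<epsilon>2
  proof -
    obtain \<delta>1 \<delta>2 where d: "\<^bold>\<diamond> \<delta>1 \<preceq> \<^bold>\<box> \<psi>" "\<^bold>\<diamond> \<delta>2 \<preceq> \<^bold>\<box> \<psi>"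
      and e: "{} \<turnstile>\<^bsub>\<S>\<^esub> \<epsilon>1 \<^bold>\<rightarrow> \<delta>1 \<^bold>\<or> \<psi>" "{} \<turnstile>\<^bsub>\<S>\<^esub> \<epsilon>2 \<^bold>\<rightarrow> \<delta>2 \<^bold>\<or> \<psi>"
      using \<epsilon> by (auto simp: D_def)
    have "{} \<turnstile>\<^bsub>\<S>\<^esub> \<epsilon>1 \<^bold>\<or> \<epsilon>2 \<^bold>\<rightarrow> (\<delta>1 \<^bold>\<or> \<delta>2) \<^bold>\<or> \<psi>"
      unfolding derives_iff_prime
    proof (intro allI impI)
      fix Q assume "prime Q"
      then interpret Q: prime_theory \<S> Q by unfold_locales
      show "Q.le (\<epsilon>1 \<^bold>\<or> \<epsilon>2) ((\<delta>1 \<^bold>\<or> \<delta>2) \<^bold>\<or> \<psi>)"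
        using Q.theorem_in[OF e(1)] Q.theorem_in[OF e(2)] unfolding Q.or_le_iff by (auto simp: Q.le_or_iff)
    qed
    moreover have "\<^bold>\<diamond> (\<delta>1 \<^bold>\<or> \<delta>2) \<preceq> \<^bold>\<box> \<psi>" using d Dia_or le_trans by blast
    ultimately show ?thesis by (auto simp: D_def)
  qed
  moreover have D: "\<delta> \<in> D" if "\<^bold>\<diamond> \<delta> \<preceq> \<^bold>\<box> \<psi>" for \<delta>
    unfolding D_def using that Goedel_ax[OF Goedel_ax.intros(6)] by blast
  ultimately obtain Q where Q: "prime Q" "\<Gamma> \<subseteq> Q" "Q \<inter> D = {}"
    using prime_extension[of D \<Gamma>] Dia_bot_le by blast
  have "\<psi> \<in> D" unfolding D_def using Dia_bot_le Goedel_ax[OF Goedel_ax.intros(7)] by blast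
  then show thesis using that[OF Q(1)] Q D by (auto simp: \<Gamma>_def)
qed

text \<open>Here \<psi> is made true, so the value of \<diamond>\<psi> has to be realised by the
  accessibility degree. If \<psi> and \<Gamma> derived \<delta>, then \<diamond>\<psi> \<le>
  \<box>(\<psi> \<rightarrow> \<delta>), and \<open>Dia_imp\<close> applied to \<psi> \<rightarrow>
  \<delta> and \<delta> would give \<diamond>\<psi> \<le> \<diamond>\<delta>. The hypothesis puts
  \<bottom> into the ideal D.\<close>

lemma Dia_witness:
  assumes "\<not> \<^bold>\<diamond> \<psi> \<preceq> \<^bold>\<bottom>"
  obtains Q where "prime Q" "\<psi> \<in> Q" "\<And>\<chi>. \<^bold>\<diamond> \<psi> \<preceq> \<^bold>\<box> \<chi> \<Longrightarrow> \<chi> \<in> Q" "\<And>\<delta>. \<not> \<^bold>\<diamond> \<psi> \<preceq> \<^bold>\<diamond> \<delta> \<Longrightarrow> \<delta> \<notin> Q"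
proof -
  define \<Gamma> where "\<Gamma> = {\<chi>. \<^bold>\<diamond> \<psi> \<preceq> \<^bold>\<box> \<chi>}"
  define D where "D = {\<delta>. \<not> \<^bold>\<diamond> \<psi> \<preceq> \<^bold>\<diamond> \<delta>}"
  have closed: "closed \<Gamma>"
    unfolding closed_def \<Gamma>_def
    using Box_theorem_in le_if_in Box_imp le_trans by blast
  have "\<not> insert \<psi> \<Gamma> \<turnstile>\<^bsub>\<S>\<^esub> \<delta>" if "\<delta> \<in> D" for \<delta>
  proof
    assume "insert \<psi> \<Gamma> \<turnstile>\<^bsub>\<S>\<^esub> \<delta>"
    then have "\<psi> \<^bold>\<rightarrow> \<delta> \<in> \<Gamma>" using deduction closed_derives[OF closed] by blast
    then have d: "\<^bold>\<diamond> \<psi> \<preceq> \<^bold>\<box> (\<psi> \<^bold>\<rightarrow> \<delta>)" by (simp add: \<Gamma>_def)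
    have "{} \<turnstile>\<^bsub>\<S>\<^esub> \<psi> \<^bold>\<rightarrow> (\<psi> \<^bold>\<rightarrow> \<delta>) \<^bold>\<rightarrow> \<delta>"
      by (intro deduction) (blast intro: derives.MP derives.Assm)
    then have "\<^bold>\<diamond> \<psi> \<preceq> \<^bold>\<diamond> ((\<psi> \<^bold>\<rightarrow> \<delta>) \<^bold>\<rightarrow> \<delta>)" by (rule Dia_mono)
    then have "\<^bold>\<diamond> \<psi> \<preceq> \<^bold>\<diamond> \<delta>" using Dia_imp d le_trans by blast
    then show False using that by (simp add: D_def)
  qed
  moreover have "\<delta> \<^bold>\<or> \<epsilon> \<in> D" if "\<delta> \<in> D" "\<epsilon> \<in> D" for \<delta> \<epsilon>
    using that Dia_or le_trans unfolding D_def by blast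
  moreover have "\<^bold>\<bottom> \<in> D" using assms Dia_bot_le le_trans unfolding D_def by blast
  ultimately obtain Q where Q: "prime Q" "insert \<psi> \<Gamma> \<subseteq> Q" "Q \<inter> D = {}"
    using prime_extension[of D "insert \<psi> \<Gamma>"] by blast
  then show thesis using that[OF Q(1)] by (auto simp: \<Gamma>_def D_def)
qed

end

subsection \<open>A chain of values shared by countably many worlds\<close>

text \<open>\<open>L a d\<close> records that the old element a is forced below the new element d,
  and \<open>U d a\<close> the converse. Where neither is forced, the new element goes strictly
  below the old one, which makes the result total.\<close>

definition glue :: "('a \<Rightarrow> 'a \<Rightarrow> bool) \<Rightarrow> ('b \<Rightarrow> 'b \<Rightarrow> bool) \<Rightarrow> ('a \<Rightarrow> 'b \<Rightarrow> bool) \<Rightarrow> ('b \<Rightarrow> 'a \<Rightarrow> bool) \<Rightarrow> 'a + 'b \<Rightarrow> 'a + 'b \<Rightarrow> bool" where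
  "glue r s L U p q = (case p of
     Inl a \<Rightarrow> (case q of Inl b \<Rightarrow> r a b | Inr d \<Rightarrow> L a d)
   | Inr d \<Rightarrow> (case q of Inl a \<Rightarrow> U d a \<or> \<not> L a d | Inr d' \<Rightarrow> s d d'))"

lemma glue_simps [simp]:
  "glue r s L U (Inl a) (Inl b) = r a b"
  "glue r s L U (Inl a) (Inr d) = L a d"
  "glue r s L U (Inr d) (Inl a) = (U d a \<or> \<not> L a d)"
  "glue r s L U (Inr d) (Inr d') = s d d'"
  by (simp_all add: glue_def)

text \<open>By \<open>UL\<close> and \<open>LU\<close>, passing through the other component forces
  nothing that was not already true. A default comparison \<open>\<not> L a d\<close> is handled by
  totality: the reverse of the desired inequality would make \<open>L\<close> true there. The set A
  is present because the old relation is controlled only on the worlds built so far.\<close>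

lemma glue_trans:
  assumes r_trans: "\<And>a b c. a \<in> A \<Longrightarrow> b \<in> A \<Longrightarrow> c \<in> A \<Longrightarrow> r a b \<Longrightarrow> r b c \<Longrightarrow> r a c"
    and r_total: "\<And>a b. a \<in> A \<Longrightarrow> b \<in> A \<Longrightarrow> r a b \<or> r b a"
    and s_trans: "\<And>d e f. s d e \<Longrightarrow> s e f \<Longrightarrow> s d f"
    and s_total: "\<And>d e. s d e \<or> s e d"
    and L: "\<And>a b d. a \<in> A \<Longrightarrow> b \<in> A \<Longrightarrow> r a b \<Longrightarrow> L b d \<Longrightarrow> L a d" "\<And>a d e. a \<in> A \<Longrightarrow> L a d \<Longrightarrow> s d e \<Longrightarrow> L a e"
    and U: "\<And>a b d. a \<in> A \<Longrightarrow> b \<in> A \<Longrightarrow> U d a \<Longrightarrow> r a b \<Longrightarrow> U d b" "\<And>a d e. a \<in> A \<Longrightarrow> s d e \<Longrightarrow> U e a \<Longrightarrow> U d a"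
    and UL: "\<And>a d e. a \<in> A \<Longrightarrow> U d a \<Longrightarrow> L a e \<Longrightarrow> s d e"
    and LU: "\<And>a b d. a \<in> A \<Longrightarrow> b \<in> A \<Longrightarrow> L a d \<Longrightarrow> U d b \<Longrightarrow> r a b"
    and pq: "glue r s L U p q" "glue r s L U q t" "p \<in> A <+> UNIV" "q \<in> A <+> UNIV" "t \<in> A <+> UNIV"
  shows "glue r s L U p t"
proof -
  consider a where "p = Inl a" "a \<in> A" | d where "p = Inr d" using pq(3) by (cases p) auto
  note p = this
  consider a where "q = Inl a" "a \<in> A" | d where "q = Inr d" using pq(4) by (cases q) auto
  note q = this
  consider a where "t = Inl a" "a \<in> A" | d where "t = Inr d" using pq(5) by (cases t) auto
  note t = this
  show ?thesis
  proof (rule p; rule q; rule t)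
    fix a b c assume "p = Inl a" "a \<in> A" "q = Inl b" "b \<in> A" "t = Inl c" "c \<in> A"
    then show ?thesis using pq(1,2) by simp (meson r_trans)
  next
    fix a b d assume "p = Inl a" "a \<in> A" "q = Inl b" "b \<in> A" "t = Inr d"
    then show ?thesis using pq(1,2) by simp (meson L(1))
  next
    fix a d b assume "p = Inl a" "a \<in> A" "q = Inr d" "t = Inl b" "b \<in> A"
    then show ?thesis using pq(1,2) by simp (meson LU L(1) r_total)
  next
    fix a d e assume "p = Inl a" "a \<in> A" "q = Inr d" "t = Inr e"
    then show ?thesis using pq(1,2) by simp (meson L(2))
  next
    fix d a b assume "p = Inr d" "q = Inl a" "a \<in> A" "t = Inl b" "b \<in> A"
    then show ?thesis using pq(1,2) by simp (meson U(1) L(1))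
  next
    fix d a e assume "p = Inr d" "q = Inl a" "a \<in> A" "t = Inr e"
    then show ?thesis using pq(1,2) by simp (meson UL L(2) s_total)
  next
    fix d e a assume "p = Inr d" "q = Inr e" "t = Inl a" "a \<in> A"
    then show ?thesis using pq(1,2) by simp (meson U(2) L(2))
  next
    fix d e f assume "p = Inr d" "q = Inr e" "t = Inr f"
    then show ?thesis using pq(1,2) by simp (meson s_trans)
  qed
qed

text \<open>A term \<open>(n, Some \<chi>)\<close> stands for the value of \<open>\<chi>\<close> at world \<open>n\<close>, and \<open>(n, None)\<close> for a lower bound
  of the accessibility of \<open>n\<close> from the world it was introduced for.\<close>

type_synonym 'v tm = "nat \<times> 'v fm option"

abbreviation Top :: "'v fm" (\<open>\<^bold>\<top>\<close>) where
  "\<^bold>\<top> \<equiv> \<^bold>\<bottom> \<^bold>\<rightarrow> \<^bold>\<bottom>"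

definition theory_at :: "('v tm \<Rightarrow> 'v tm \<Rightarrow> bool) \<Rightarrow> nat \<Rightarrow> 'v fm set" where
  "theory_at R n = {\<chi>. R (n, Some \<^bold>\<top>) (n, Some \<chi>)}"

text \<open>A numberless form of the claim that the accessibility degree from n to m is at least the
  value of \<open>(m, None)\<close>. On the box side the inequality holds outright, without help
  from the bound.\<close>

definition accessible :: "('v tm \<Rightarrow> 'v tm \<Rightarrow> bool) \<Rightarrow> nat \<Rightarrow> nat \<Rightarrow> bool" where
  "accessible R n m \<longleftrightarrow> (\<forall>\<chi>. R (n, Some (\<^bold>\<box> \<chi>)) (m, Some \<chi>) \<and>
     (R (m, Some \<chi>) (n, Some (\<^bold>\<diamond> \<chi>)) \<or> R (m, None) (n, Some (\<^bold>\<diamond> \<chi>))))"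

section \<open>Extending the chain by one world\<close>

context calculus
begin

text \<open>All worlds share their top and bottom classes. The last clause puts
  \<open>(n, None)\<close> strictly above every formula that is not true at n, so that the bound can
  separate such a formula from its accessibility degree.\<close>

definition chain_upto :: "nat \<Rightarrow> ('v tm \<Rightarrow> 'v tm \<Rightarrow> bool) \<Rightarrow> bool" where
  "chain_upto k R \<longleftrightarrow>
     (\<forall>x y z. fst x \<le> k \<longrightarrow> fst y \<le> k \<longrightarrow> fst z \<le> k \<longrightarrow> R x y \<longrightarrow> R y z \<longrightarrow> R x z) \<and>
     (\<forall>x y. fst x \<le> k \<longrightarrow> fst y \<le> k \<longrightarrow> R x y \<or> R y x) \<and>
     (\<forall>x n. fst x \<le> k \<longrightarrow> n \<le> k \<longrightarrow> R x (n, Some \<^bold>\<top>) \<and> R (n, Some \<^bold>\<bottom>) x) \<and>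
     (\<forall>n\<le>k. prime (theory_at R n) \<and>
        (\<forall>\<phi> \<psi>. R (n, Some \<phi>) (n, Some \<psi>) \<longleftrightarrow> \<phi> \<^bold>\<rightarrow> \<psi> \<in> theory_at R n) \<and>
        (\<forall>\<phi>. R (n, None) (n, Some \<phi>) \<longleftrightarrow> \<phi> \<in> theory_at R n))"

lemma chain_uptoD:
  assumes "chain_upto k R"
  shows "fst x \<le> k \<Longrightarrow> fst y \<le> k \<Longrightarrow> fst z \<le> k \<Longrightarrow> R x y \<Longrightarrow> R y z \<Longrightarrow> R x z"
    and "fst x \<le> k \<Longrightarrow> fst y \<le> k \<Longrightarrow> R x y \<or> R y x"
    and "fst x \<le> k \<Longrightarrow> n \<le> k \<Longrightarrow> R x (n, Some \<^bold>\<top>)"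
    and "fst x \<le> k \<Longrightarrow> n \<le> k \<Longrightarrow> R (n, Some \<^bold>\<bottom>) x"
    and "n \<le> k \<Longrightarrow> prime (theory_at R n)"
    and "n \<le> k \<Longrightarrow> R (n, Some \<phi>) (n, Some \<psi>) \<longleftrightarrow> \<phi> \<^bold>\<rightarrow> \<psi> \<in> theory_at R n"
    and "n \<le> k \<Longrightarrow> R (n, None) (n, Some \<phi>) \<longleftrightarrow> \<phi> \<in> theory_at R n"
  using assms unfolding chain_upto_def by blast+

definition agree_upto :: "nat \<Rightarrow> ('v tm \<Rightarrow> 'v tm \<Rightarrow> bool) \<Rightarrow> ('v tm \<Rightarrow> 'v tm \<Rightarrow> bool) \<Rightarrow> bool" where
  "agree_upto k R R' \<longleftrightarrow> (\<forall>x y. fst x \<le> k \<longrightarrow> fst y \<le> k \<longrightarrow> R' x y = R x y)"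

lemma agree_upto_theory_at: "agree_upto k R R' \<Longrightarrow> n \<le> k \<Longrightarrow> theory_at R' n = theory_at R n"
  by (auto simp: agree_upto_def theory_at_def)

text \<open>One construction serves both modalities, which differ only in the cut \<open>I\<close>:
  the terms at most \<box>\<psi>, or the terms strictly below \<diamond>\<psi>. The new bound fills
  the cut.\<close>

lemma chain_extension:
  assumes R: "chain_upto k R" and n: "n \<le> k"
    and I: "\<And>x y. fst x \<le> k \<Longrightarrow> fst y \<le> k \<Longrightarrow> R x y \<Longrightarrow> y \<in> I \<Longrightarrow> x \<in> I"
    and I_bot: "(n, Some \<^bold>\<bottom>) \<in> I" and I_top: "(n, Some \<^bold>\<top>) \<notin> I"
    and Q: "prime Q"
    and Q_Box: "\<And>\<chi>. (n, Some (\<^bold>\<box> \<chi>)) \<notin> I \<Longrightarrow> \<chi> \<in> Q"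
    and Q_Dia: "\<And>\<chi>. (n, Some (\<^bold>\<diamond> \<chi>)) \<in> I \<Longrightarrow> \<chi> \<notin> Q"
  obtains R' where "chain_upto (Suc k) R'" "agree_upto k R R'" "theory_at R' (Suc k) = Q"
    "accessible R' n (Suc k)"
    "\<And>x. fst x \<le> k \<Longrightarrow> R' x (Suc k, None) \<longleftrightarrow> x \<in> I"
    "\<And>x. fst x \<le> k \<Longrightarrow> R' (Suc k, None) x \<longleftrightarrow> x \<notin> I"
proof -
  interpret P: prime_theory \<S> "theory_at R n"
    using chain_uptoD(5)[OF R n] by unfold_locales
  interpret Q: prime_theory \<S> Q
    using Q by unfold_locales
  note R_trans = chain_uptoD(1)[OF R] and R_total = chain_uptoD(2)[OF R]
    and R_top = chain_uptoD(3)[OF R] and R_bot = chain_uptoD(4)[OF R]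
    and R_P = chain_uptoD(6)[OF R n]
  have R_refl: "R x x" if "fst x \<le> k" for x using R_total that by blast
  have above_I: "R x y" if "x \<in> I" "y \<notin> I" "fst x \<le> k" "fst y \<le> k" for x y
    using that R_total I by blast
  \<comment> \<open>A true \<box>(\<phi> \<rightarrow> \<psi>) is a top element, hence outside
    \<open>I\<close>, and Q must contain \<phi> \<rightarrow> \<psi>. This is what \<open>UL\<close>
    will need.\<close>
  have le_if: "Q.le \<phi> \<psi>" if "R (n, Some (\<^bold>\<diamond> \<phi>)) (n, Some (\<^bold>\<box> \<psi>))" for \<phi> \<psi>
  proof (rule Q_Box)
    have "\<^bold>\<box> (\<phi> \<^bold>\<rightarrow> \<psi>) \<in> theory_at R n" using that P.Box_imp_in by (simp add: R_P)
    then have "R (n, Some \<^bold>\<top>) (n, Some (\<^bold>\<box> (\<phi> \<^bold>\<rightarrow> \<psi>)))" by (simp add: theory_at_def)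
    then show "(n, Some (\<^bold>\<box> (\<phi> \<^bold>\<rightarrow> \<psi>))) \<notin> I" using I I_top n by auto
  qed
  \<comment> \<open>Here \<diamond>(\<psi> \<rightarrow> \<phi>) falls to \<diamond>\<phi>, inside
    \<open>I\<close>, so Q must omit \<psi> \<rightarrow> \<phi>. This is what \<open>LU\<close>
    will need, in contrapositive form.\<close>
  have not_le_if: "\<not> Q.le \<psi> \<phi>" if "\<not> R (n, Some (\<^bold>\<box> \<psi>)) (n, Some (\<^bold>\<diamond> \<phi>))" "(n, Some (\<^bold>\<diamond> \<phi>)) \<in> I" for \<phi> \<psi>
  proof (rule Q_Dia)
    have "R (n, Some (\<^bold>\<diamond> (\<psi> \<^bold>\<rightarrow> \<phi>))) (n, Some (\<^bold>\<diamond> \<phi>))" using that(1) P.Dia_imp[of \<psi> \<phi>] by (simp add: R_P)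
    then show "(n, Some (\<^bold>\<diamond> (\<psi> \<^bold>\<rightarrow> \<phi>))) \<in> I" using I that(2) n by auto
  qed

  \<comment> \<open>\<open>None\<close> is placed strictly between the formulas outside Q and those
    in Q.\<close>
  define s where "s d e = (case d of
      None \<Rightarrow> (case e of None \<Rightarrow> True | Some \<psi> \<Rightarrow> \<psi> \<in> Q)
    | Some \<phi> \<Rightarrow> (case e of None \<Rightarrow> \<phi> \<notin> Q | Some \<psi> \<Rightarrow> Q.le \<phi> \<psi>))" for d e
  \<comment> \<open>A formula of Q is above everything; any other must be above x when x \<le>
    \<box>\<chi> in the old chain and \<chi> \<le> \<phi> in Q.\<close>
  define L where "L x d = (case d of
      None \<Rightarrow> x \<in> I
    | Some \<phi> \<Rightarrow> \<phi> \<in> Q \<or> (\<exists>\<chi>. Q.le \<chi> \<phi> \<and> R x (n, Some (\<^bold>\<box> \<chi>))))" for x d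
  \<comment> \<open>A formula of Q has only top elements above it. Any other lies below all terms
    outside \<open>I\<close>, and below x when \<phi> \<le> \<chi> in Q and \<diamond>\<chi> \<le> x
    in the old chain.\<close>
  define U where "U d x = (case d of
      None \<Rightarrow> x \<notin> I
    | Some \<phi> \<Rightarrow> if \<phi> \<in> Q then R (n, Some \<^bold>\<top>) x else x \<notin> I \<or> (\<exists>\<chi>. Q.le \<phi> \<chi> \<and> R (n, Some (\<^bold>\<diamond> \<chi>)) x))" for d x
  \<comment> \<open>Terms of still later worlds are lumped together with the new one, so
    \<open>R'\<close> is a total preorder everywhere; the claims concern worlds up to
    \<open>Suc k\<close> only.\<close>
  define side where "side x = (if fst x \<le> k then Inl x else Inr (snd x))" for x :: "'v tm"
  define R' where "R' x y = glue R s L U (side x) (side y)" for x y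
  let ?A = "{x. fst x \<le> k}"

  have not_in_Q: "\<phi> \<notin> Q" if "Q.le \<phi> \<psi>" "\<psi> \<notin> Q" for \<phi> \<psi> using that Q.mp by blast
  have Box_I: "(n, Some (\<^bold>\<box> \<chi>)) \<in> I" if "\<chi> \<notin> Q" for \<chi> using Q_Box that by blast
  have L_I: "x \<in> I" if "fst x \<le> k" "L x (Some \<phi>)" "\<phi> \<notin> Q" for x \<phi>
    using that I[of x] Box_I not_in_Q n by (auto simp: L_def)
  have top_notin: "x \<notin> I" if "fst x \<le> k" "R (n, Some \<^bold>\<top>) x" for x
    using I[OF _ _ that(2)] that(1) I_top n by auto

  have s_trans: "s d f" if "s d e" "s e f" for d e f
    using that by (cases d; cases e; cases f) (simp_all add: s_def, (meson Q.mp Q.le_trans Q.le_if_in)+)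
  have s_total: "s d e \<or> s e d" for d e
    using Q.le_total by (auto simp: s_def split: option.splits)
  have L1: "L a d" if "a \<in> ?A" "b \<in> ?A" "R a b" "L b d" for a b d
  proof (cases d)
    case None
    then show ?thesis using that I[OF _ _ that(3)] by (auto simp: L_def)
  next
    case (Some \<phi>)
    have "R a (n, z)" if "R b (n, z)" for z
      using R_trans[OF _ _ _ \<open>R a b\<close> that] \<open>a \<in> ?A\<close> \<open>b \<in> ?A\<close> n by simp
    then show ?thesis using that(4) Some by (auto simp: L_def)
  qed
  have L2: "L a e" if "a \<in> ?A" "L a d" "s d e" for a d e
  proof (cases e)
    case None
    then show ?thesis using that L_I[of a] by (cases d) (auto simp: s_def L_def)
  next
    case (Some \<psi>)
    then show ?thesis using that
      by (cases d) (simp_all add: s_def L_def, meson Q.mp Q.le_trans)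
  qed
  have U1: "U d b" if "a \<in> ?A" "b \<in> ?A" "U d a" "R a b" for a b d
  proof (cases "\<exists>\<phi>. d = Some \<phi>")
    case True
    then obtain \<phi> where "d = Some \<phi>" ..
    moreover have "R (n, z) b" if "R (n, z) a" for z
      using R_trans[OF _ _ _ that \<open>R a b\<close>] \<open>a \<in> ?A\<close> \<open>b \<in> ?A\<close> n by simp
    moreover have "b \<notin> I" if "a \<notin> I" using I[OF _ _ \<open>R a b\<close>] that \<open>a \<in> ?A\<close> \<open>b \<in> ?A\<close> by auto
    ultimately show ?thesis using \<open>U d a\<close> by (auto simp: U_def split: if_splits)
  next
    case False
    then show ?thesis using that I[OF _ _ that(4)] by (auto simp: U_def)
  qed
  have U2: "U d a" if "a \<in> ?A" "s d e" "U e a" for a d e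
  proof (cases d)
    case None
    then show ?thesis using that top_notin[of a] by (cases e) (auto simp: s_def U_def)
  next
    case (Some \<phi>)
    show ?thesis
    proof (cases e)
      case None
      then show ?thesis using that Some by (auto simp: s_def U_def)
    next
      fix \<psi> assume e: "e = Some \<psi>"
      then have "Q.le \<phi> \<psi>" using that Some by (simp add: s_def)
      then show ?thesis using that(1,3) Some e top_notin[of a]
        by (auto simp: U_def split: if_splits dest: Q.mp intro: Q.le_trans)
    qed
  qed
  have UL: "s d e" if ad: "a \<in> ?A" "U d a" "L a e" for a d e
  proof (cases "a \<in> I")
    case False
    have "\<psi> \<in> Q" if "e = Some \<psi>" for \<psi> using L_I \<open>a \<in> ?A\<close> \<open>L a e\<close> False that by blast
    then show ?thesis using ad(3) False Q.le_if_in by (auto simp: s_def L_def split: option.splits)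
  next
    case True
    then obtain \<phi> \<chi> where d: "d = Some \<phi>" "\<phi> \<notin> Q" "Q.le \<phi> \<chi>" "R (n, Some (\<^bold>\<diamond> \<chi>)) a"
      using ad(1,2) top_notin by (auto simp: U_def split: option.splits if_splits)
    show ?thesis
    proof (cases e)
      case None
      then show ?thesis using d by (simp add: s_def)
    next
      case (Some \<psi>)
      have "Q.le \<phi> \<psi>" if "Q.le \<chi>' \<psi>" "R a (n, Some (\<^bold>\<box> \<chi>'))" for \<chi>'
      proof -
        have "R (n, Some (\<^bold>\<diamond> \<chi>)) (n, Some (\<^bold>\<box> \<chi>'))" using R_trans[OF _ _ _ d(4) that(2)] \<open>a \<in> ?A\<close> n by simp
        then show ?thesis using le_if d(3) that(1) Q.le_trans by blast
      qed
      then show ?thesis using ad(3) Some d(1) Q.le_if_in by (auto simp: s_def L_def)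
    qed
  qed
  have LU: "R a b" if ab: "a \<in> ?A" "b \<in> ?A" "L a d" "U d b" for a b d
  proof (cases "a \<in> I \<and> b \<notin> I")
    case True
    then show ?thesis using above_I ab by blast
  next
    case False
    then obtain \<phi> where d: "d = Some \<phi>" using ab(3,4) by (auto simp: L_def U_def split: option.splits)
    show ?thesis
    proof (cases "\<phi> \<in> Q")
      case True
      then have "R (n, Some \<^bold>\<top>) b" using ab(4) d by (simp add: U_def)
      then show ?thesis using R_trans[of a "(n, Some \<^bold>\<top>)" b] R_top ab n by simp
    next
      case notQ: False
      then have "a \<in> I" using L_I ab d by blast
      then have "b \<in> I" using False by blast
      obtain \<chi> where c: "Q.le \<chi> \<phi>" "R a (n, Some (\<^bold>\<box> \<chi>))" using ab(3) d notQ by (auto simp: L_def)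
      obtain \<chi>' where c': "Q.le \<phi> \<chi>'" "R (n, Some (\<^bold>\<diamond> \<chi>')) b"
        using ab(4) d notQ \<open>b \<in> I\<close> by (auto simp: U_def)
      have "(n, Some (\<^bold>\<diamond> \<chi>')) \<in> I" using I[OF _ _ c'(2) \<open>b \<in> I\<close>] ab(2) n by simp
      then have "R (n, Some (\<^bold>\<box> \<chi>)) (n, Some (\<^bold>\<diamond> \<chi>'))" using not_le_if c(1) c'(1) Q.le_trans by blast
      then have "R a (n, Some (\<^bold>\<diamond> \<chi>'))" using R_trans[OF _ _ _ c(2)] ab(1) n by simp
      then show ?thesis using R_trans[OF _ _ _ _ c'(2)] ab(1,2) n by simp
    qed
  qed

  have R_trans_A: "R a c" if "a \<in> ?A" "b \<in> ?A" "c \<in> ?A" "R a b" "R b c" for a b c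
    using R_trans[OF _ _ _ that(4,5)] that(1-3) by simp
  have R_total_A: "R a b \<or> R b a" if "a \<in> ?A" "b \<in> ?A" for a b
    using R_total that by simp
  have side_in: "side x \<in> ?A <+> UNIV" for x by (auto simp: side_def)
  have trans': "R' x z" if "R' x y" "R' y z" for x y z
    unfolding R'_def
  proof (rule glue_trans[of ?A R s L U "side x" "side y" "side z"])
    show "glue R s L U (side x) (side y)" "glue R s L U (side y) (side z)" using that by (simp_all add: R'_def)
  qed (fact R_trans_A R_total_A s_trans s_total L1 L2 U1 U2 UL LU side_in)+
  have total': "R' x y \<or> R' y x" for x y
    using R_total s_total by (auto simp: R'_def side_def)
  have old: "R' x y = R x y" if "fst x \<le> k" "fst y \<le> k" for x y
    using that by (simp add: R'_def side_def)
  then have agree: "agree_upto k R R'" by (simp add: agree_upto_def)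
  have new: "R' (Suc k, d) (Suc k, e) = s d e" for d e by (simp add: R'_def side_def)
  have old_new: "R' x (Suc k, d) = L x d" and new_old: "R' (Suc k, d) x \<longleftrightarrow> U d x \<or> \<not> L x d"
    if "fst x \<le> k" for x d using that by (simp_all add: R'_def side_def)
  have Top_Q: "\<^bold>\<top> \<in> Q" by (rule Q.le_refl)
  have "Q.le \<^bold>\<top> \<phi> \<longleftrightarrow> \<phi> \<in> Q" for \<phi>
    using Top_Q Q.mp Q.le_if_in by blast
  then have Q_eq: "theory_at R' (Suc k) = Q"
    by (simp add: theory_at_def new s_def)
  have top': "R' x (Suc k, Some \<^bold>\<top>)" if "fst x \<le> Suc k" for x
  proof (cases "fst x \<le> k")
    case True
    then show ?thesis using Top_Q by (simp add: old_new L_def)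
  next
    case False
    then have "x = (Suc k, snd x)" using that by (cases x) simp
    moreover have "s (snd x) (Some \<^bold>\<top>)"
      using Top_Q Q.le_if_in[OF Top_Q] by (cases "snd x") (simp_all add: s_def)
    ultimately show ?thesis by (metis new)
  qed
  have top'': "R' (Suc k, Some \<^bold>\<top>) (m, Some \<^bold>\<top>)" if "m \<le> k" for m
    using that Top_Q n R_top by (auto simp: new_old U_def)
  have bot': "R' (Suc k, Some \<^bold>\<bottom>) x" if "fst x \<le> Suc k" for x
  proof (cases "fst x \<le> k")
    case True
    \<comment> \<open>The axiom on \<diamond>\<bottom> identifies the new bottom with the old ones:
      the new \<bottom> is forced below \<diamond>\<bottom>, which is itself an old bottom.\<close>
    have "R (n, Some (\<^bold>\<diamond> \<^bold>\<bottom>)) (n, Some \<^bold>\<bottom>)" using P.Dia_bot_le by (simp add: R_P)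
    then have "R (n, Some (\<^bold>\<diamond> \<^bold>\<bottom>)) x" using R_trans[of _ "(n, Some \<^bold>\<bottom>)" x] R_bot True n by simp
    then have "U (Some \<^bold>\<bottom>) x" using Q.le_refl Q.bot_notin by (auto simp: U_def)
    then show ?thesis using True by (simp add: new_old)
  next
    case False
    then have "x = (Suc k, snd x)" using that by (cases x) simp
    moreover have "s (Some \<^bold>\<bottom>) (snd x)"
      using Q.bot_le Q.bot_notin by (cases "snd x") (simp_all add: s_def)
    ultimately show ?thesis by (metis new)
  qed
  have bot'': "R' (m, Some \<^bold>\<bottom>) (Suc k, Some \<^bold>\<bottom>)" if "m \<le> k" for m
  proof -
    have "R (m, Some \<^bold>\<bottom>) (n, Some (\<^bold>\<box> \<^bold>\<bottom>))" using R_bot that n by simp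
    then have "L (m, Some \<^bold>\<bottom>) (Some \<^bold>\<bottom>)" using Q.le_refl unfolding L_def by auto
    then show ?thesis using that by (simp add: old_new)
  qed
  have "chain_upto (Suc k) R'"
    unfolding chain_upto_def
  proof (intro conjI allI impI)
    show "R' x (m, Some \<^bold>\<top>)" if "fst x \<le> Suc k" "m \<le> Suc k" for x m
      using that(2) top'[OF that(1)] trans'[OF top'[OF that(1)] top''] by (auto simp: le_Suc_eq)
    show "R' (m, Some \<^bold>\<bottom>) x" if "fst x \<le> Suc k" "m \<le> Suc k" for x m
      using that(2) bot'[OF that(1)] trans'[OF bot'' bot'[OF that(1)]] by (auto simp: le_Suc_eq)
    fix m assume m: "m \<le> Suc k"
    have "prime (theory_at R' m) \<and>
        (\<forall>\<phi> \<psi>. R' (m, Some \<phi>) (m, Some \<psi>) \<longleftrightarrow> \<phi> \<^bold>\<rightarrow> \<psi> \<in> theory_at R' m) \<and>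
        (\<forall>\<phi>. R' (m, None) (m, Some \<phi>) \<longleftrightarrow> \<phi> \<in> theory_at R' m)"
    proof (cases "m \<le> k")
      case True
      then show ?thesis using chain_uptoD(5-7)[OF R True] agree_upto_theory_at[OF agree True]
        by (simp add: old)
    next
      case False
      then have "m = Suc k" using m by simp
      then show ?thesis using Q Q_eq by (simp add: new s_def)
    qed
    then show "prime (theory_at R' m)"
      and "R' (m, Some \<phi>) (m, Some \<psi>) \<longleftrightarrow> \<phi> \<^bold>\<rightarrow> \<psi> \<in> theory_at R' m"
      and "R' (m, None) (m, Some \<phi>) \<longleftrightarrow> \<phi> \<in> theory_at R' m" for \<phi> \<psi> by blast+
  qed (use trans' total' in blast)+
  moreover have "accessible R' n (Suc k)"
    unfolding accessible_def
  proof (intro allI conjI)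
    fix \<chi>
    have "L (n, Some (\<^bold>\<box> \<chi>)) (Some \<chi>)"
      using Q.le_refl R_refl[of "(n, Some (\<^bold>\<box> \<chi>))"] n unfolding L_def option.case fst_conv by blast
    then show "R' (n, Some (\<^bold>\<box> \<chi>)) (Suc k, Some \<chi>)" using n by (simp add: old_new)
    have "U (Some \<chi>) (n, Some (\<^bold>\<diamond> \<chi>)) \<or> U None (n, Some (\<^bold>\<diamond> \<chi>))"
      using Q.le_refl R_refl[of "(n, Some (\<^bold>\<diamond> \<chi>))"] n Q_Dia[of \<chi>]
      unfolding U_def option.case fst_conv by (cases "\<chi> \<in> Q") (simp_all only: if_True if_False, blast+)
    then show "R' (Suc k, Some \<chi>) (n, Some (\<^bold>\<diamond> \<chi>)) \<or> R' (Suc k, None) (n, Some (\<^bold>\<diamond> \<chi>))"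
      using n by (auto simp: new_old)
  qed
  ultimately show thesis
    using that[of R'] agree Q_eq by (simp add: old_new new_old L_def U_def)
qed

end

section \<open>Scheduling the witnesses and passing to the limit\<close>

lemma repeating_enumeration:
  assumes "countable (UNIV :: 'a set)"
  obtains f :: "nat \<Rightarrow> 'a" where "\<And>x k. \<exists>i\<ge>k. f i = x"
proof
  let ?f = "\<lambda>i. from_nat_into (UNIV :: 'a set) (fst (prod_decode i))"
  fix x :: 'a and k
  obtain n where "from_nat_into UNIV n = x" using from_nat_into_surj[OF assms] by blast
  \<comment> \<open>The second component of the pair only serves to make the index as large as
    desired.\<close>
  then have "?f (prod_encode (n, k)) = x" by simp
  then show "\<exists>i\<ge>k. ?f i = x" using le_prod_encode_2 by blast
qed

context calculus
begin

text \<open>The new bound is squeezed between \<box>\<psi> and all older terms above it, strictly on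
  both sides. Repeated for ever, this leaves \<box>\<psi> without an immediate successor.
  \<open>Dia_done\<close> is the mirror image.\<close>

definition Box_done :: "nat \<Rightarrow> ('v tm \<Rightarrow> 'v tm \<Rightarrow> bool) \<Rightarrow> nat \<Rightarrow> 'v fm \<Rightarrow> bool" where
  "Box_done k R n \<psi> \<longleftrightarrow> accessible R n (Suc k) \<and> \<psi> \<notin> theory_at R (Suc k) \<and>
     (\<forall>x. fst x \<le> k \<longrightarrow> \<not> R x (n, Some (\<^bold>\<box> \<psi>)) \<longrightarrow> \<not> R x (Suc k, None)) \<and>
     \<not> R (Suc k, None) (n, Some (\<^bold>\<box> \<psi>))"

definition Dia_done :: "nat \<Rightarrow> ('v tm \<Rightarrow> 'v tm \<Rightarrow> bool) \<Rightarrow> nat \<Rightarrow> 'v fm \<Rightarrow> bool" where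
  "Dia_done k R n \<psi> \<longleftrightarrow> accessible R n (Suc k) \<and> \<psi> \<in> theory_at R (Suc k) \<and>
     (\<forall>x. fst x \<le> k \<longrightarrow> \<not> R (n, Some (\<^bold>\<diamond> \<psi>)) x \<longrightarrow> \<not> R (Suc k, None) x) \<and>
     \<not> R (n, Some (\<^bold>\<diamond> \<psi>)) (Suc k, None)"

lemma Box_step:
  assumes R: "chain_upto k R" and n: "n \<le> k" and \<psi>: "\<^bold>\<box> \<psi> \<notin> theory_at R n"
  shows "\<exists>R'. chain_upto (Suc k) R' \<and> agree_upto k R R' \<and> Box_done k R' n \<psi>"
proof -
  interpret P: prime_theory \<S> "theory_at R n"
    using chain_uptoD(5)[OF R n] by unfold_locales
  obtain Q where Q: "prime Q" "\<psi> \<notin> Q" "\<And>\<chi>. \<not> P.le (\<^bold>\<box> \<chi>) (\<^bold>\<box> \<psi>) \<Longrightarrow> \<chi> \<in> Q" "\<And>\<delta>. P.le (\<^bold>\<diamond> \<delta>) (\<^bold>\<box> \<psi>) \<Longrightarrow> \<delta> \<notin> Q"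
    using P.Box_witness[OF \<psi>] by blast
  \<comment> \<open>The cut includes \<box>\<psi> itself, so the new bound comes strictly above
    it.\<close>
  let ?I = "{x. R x (n, Some (\<^bold>\<box> \<psi>))}"
  have down: "x \<in> ?I" if "fst x \<le> k" "fst y \<le> k" "R x y" "y \<in> ?I" for x y
    using chain_uptoD(1)[OF R _ _ _ that(3)] that n by simp
  have bounds: "(n, Some \<^bold>\<bottom>) \<in> ?I" "(n, Some \<^bold>\<top>) \<notin> ?I"
    using chain_uptoD(4)[OF R] n \<psi> by (auto simp: theory_at_def)
  have modal: "\<And>\<chi>. (n, Some (\<^bold>\<box> \<chi>)) \<notin> ?I \<Longrightarrow> \<chi> \<in> Q" "\<And>\<chi>. (n, Some (\<^bold>\<diamond> \<chi>)) \<in> ?I \<Longrightarrow> \<chi> \<notin> Q"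
    using Q(3,4) chain_uptoD(6)[OF R n] by auto
  show ?thesis
  proof (rule chain_extension[OF R n down bounds Q(1) modal])
    fix R' assume R': "chain_upto (Suc k) R'" "agree_upto k R R'" "theory_at R' (Suc k) = Q"
      "accessible R' n (Suc k)"
      "\<And>x. fst x \<le> k \<Longrightarrow> R' x (Suc k, None) \<longleftrightarrow> x \<in> ?I"
      "\<And>x. fst x \<le> k \<Longrightarrow> R' (Suc k, None) x \<longleftrightarrow> x \<notin> ?I"
    let ?a = "(n, Some (\<^bold>\<box> \<psi>))"
    have "R ?a ?a" using chain_uptoD(2)[OF R, of ?a ?a] n by simp
    then have "Box_done k R' n \<psi>"
      using R' Q(2) n by (simp add: Box_done_def agree_upto_def)
    then show ?thesis using R' by blast
  qed
qed

lemma Dia_step: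
  assumes R: "chain_upto k R" and n: "n \<le> k" and \<psi>: "\<not> R (n, Some (\<^bold>\<diamond> \<psi>)) (n, Some \<^bold>\<bottom>)"
  shows "\<exists>R'. chain_upto (Suc k) R' \<and> agree_upto k R R' \<and> Dia_done k R' n \<psi>"
proof -
  interpret P: prime_theory \<S> "theory_at R n"
    using chain_uptoD(5)[OF R n] by unfold_locales
  have "\<not> P.le (\<^bold>\<diamond> \<psi>) \<^bold>\<bottom>" using \<psi> chain_uptoD(6)[OF R n] by simp
  then obtain Q where Q: "prime Q" "\<psi> \<in> Q" "\<And>\<chi>. P.le (\<^bold>\<diamond> \<psi>) (\<^bold>\<box> \<chi>) \<Longrightarrow> \<chi> \<in> Q" "\<And>\<delta>. \<not> P.le (\<^bold>\<diamond> \<psi>) (\<^bold>\<diamond> \<delta>) \<Longrightarrow> \<delta> \<notin> Q"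
    using P.Dia_witness by blast
  \<comment> \<open>The cut stops short of \<diamond>\<psi>, so the new bound comes strictly below
    it.\<close>
  let ?I = "{x. \<not> R (n, Some (\<^bold>\<diamond> \<psi>)) x}"
  have down: "x \<in> ?I" if "fst x \<le> k" "fst y \<le> k" "R x y" "y \<in> ?I" for x y
    using chain_uptoD(1)[OF R _ _ _ _ that(3)] that n by auto
  have bounds: "(n, Some \<^bold>\<bottom>) \<in> ?I" "(n, Some \<^bold>\<top>) \<notin> ?I"
    using chain_uptoD(3)[OF R] n \<psi> by auto
  have modal: "\<And>\<chi>. (n, Some (\<^bold>\<box> \<chi>)) \<notin> ?I \<Longrightarrow> \<chi> \<in> Q" "\<And>\<chi>. (n, Some (\<^bold>\<diamond> \<chi>)) \<in> ?I \<Longrightarrow> \<chi> \<notin> Q"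
    using Q(3,4) chain_uptoD(6)[OF R n] by auto
  show ?thesis
  proof (rule chain_extension[OF R n down bounds Q(1) modal])
    fix R' assume R': "chain_upto (Suc k) R'" "agree_upto k R R'" "theory_at R' (Suc k) = Q"
      "accessible R' n (Suc k)"
      "\<And>x. fst x \<le> k \<Longrightarrow> R' x (Suc k, None) \<longleftrightarrow> x \<in> ?I"
      "\<And>x. fst x \<le> k \<Longrightarrow> R' (Suc k, None) x \<longleftrightarrow> x \<notin> ?I"
    let ?a = "(n, Some (\<^bold>\<diamond> \<psi>))"
    have "R ?a ?a" using chain_uptoD(2)[OF R, of ?a ?a] n by simp
    then have "Dia_done k R' n \<psi>"
      using R' Q(2) n by (simp add: Dia_done_def agree_upto_def)
    then show ?thesis using R' by blast
  qed
qed

definition task_done :: "nat \<Rightarrow> ('v tm \<Rightarrow> 'v tm \<Rightarrow> bool) \<Rightarrow> nat \<times> 'v fm \<times> bool \<Rightarrow> bool" where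
  "task_done k R = (\<lambda>(n, \<psi>, is_box). n \<le> k \<longrightarrow>
     (if is_box then \<^bold>\<box> \<psi> \<notin> theory_at R n \<longrightarrow> Box_done k R n \<psi>
      else \<not> R (n, Some (\<^bold>\<diamond> \<psi>)) (n, Some \<^bold>\<bottom>) \<longrightarrow> Dia_done k R n \<psi>))"

lemma task_step:
  assumes R: "chain_upto k R"
  shows "\<exists>R'. chain_upto (Suc k) R' \<and> agree_upto k R R' \<and> task_done k R' t"
proof -
  obtain n \<psi> b where t: "t = (n, \<psi>, b)" by (cases t)
  interpret P: prime_theory \<S> "theory_at R 0"
    using chain_uptoD(5)[OF R] by unfold_locales simp
  have "\<^bold>\<diamond> \<^bold>\<top> \<in> theory_at R 0"
    using GT_BD_subset GT_BD.intros(3) P.theorem_in derives.Ax P.mp P.le_refl by blast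
  then have "\<not> R (0, Some (\<^bold>\<diamond> \<^bold>\<top>)) (0, Some \<^bold>\<bottom>)"
    using chain_uptoD(6)[OF R] P.mp P.bot_notin by blast
  \<comment> \<open>Every stage must add a world even if its task is void. A witness for
    \<diamond>\<top> at world 0 always exists, as \<diamond>\<top> is true by \<phi> \<rightarrow>
    \<diamond>\<phi>.\<close>
  then have default: "\<exists>R'. chain_upto (Suc k) R' \<and> agree_upto k R R'"
    using Dia_step[OF R] by blast
  have same: "agree_upto k R R' \<Longrightarrow> n \<le> k \<Longrightarrow> R' (n, a) (n, b) = R (n, a) (n, b)" for R' a b
    by (simp add: agree_upto_def)
  consider "n > k" | "b" "n \<le> k" "\<^bold>\<box> \<psi> \<in> theory_at R n" | "b" "n \<le> k" "\<^bold>\<box> \<psi> \<notin> theory_at R n"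
    | "\<not> b" "n \<le> k" "R (n, Some (\<^bold>\<diamond> \<psi>)) (n, Some \<^bold>\<bottom>)" | "\<not> b" "n \<le> k" "\<not> R (n, Some (\<^bold>\<diamond> \<psi>)) (n, Some \<^bold>\<bottom>)"
    by linarith
  then show ?thesis
  proof cases
    case 3
    then show ?thesis using Box_step[OF R 3(2,3)] t by (auto simp: task_done_def)
  next
    case 5
    then show ?thesis using Dia_step[OF R 5(2,3)] t by (auto simp: task_done_def)
  qed (use default t same agree_upto_theory_at in \<open>auto simp: task_done_def\<close>)
qed

lemma chain_upto_0:
  assumes "prime P"
  obtains R where "chain_upto 0 R" "theory_at R 0 = P"
proof -
  interpret P: prime_theory \<S> P using assms by unfold_locales
  \<comment> \<open>World 0 is not introduced for another world; giving its bound the top value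
    satisfies the clause on \<open>None\<close>.\<close>
  define g where "g x = (case snd x of None \<Rightarrow> \<^bold>\<top> | Some \<phi> \<Rightarrow> \<phi>)" for x :: "'v tm"
  define R where "R x y \<longleftrightarrow> P.le (g x) (g y)" for x y
  have Top: "P.le \<^bold>\<top> \<phi> \<longleftrightarrow> \<phi> \<in> P" for \<phi> using P.le_refl P.mp P.le_if_in by blast
  have th: "theory_at R 0 = P" by (auto simp: theory_at_def R_def g_def Top)
  have "chain_upto 0 R"
    unfolding chain_upto_def
  proof (intro conjI allI impI)
    show "R x z" if "R x y" "R y z" for x y z using that P.le_trans unfolding R_def by blast
    show "R x y \<or> R y x" for x y using P.le_total unfolding R_def by blast
    show "R x (n, Some \<^bold>\<top>)" and "R (n, Some \<^bold>\<bottom>) x" for x n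
      using P.le_if_in[OF P.le_refl] P.bot_le by (simp_all add: R_def g_def)
  qed (use th assms Top in \<open>simp_all add: R_def g_def\<close>)
  then show thesis using that th by blast
qed

lemma agree_upto_chain_upto:
  assumes "agree_upto k R R'" "chain_upto k R"
  shows "chain_upto k R'"
proof -
  have *: "R' x y = R x y" if "fst x \<le> k" "fst y \<le> k" for x y
    using assms(1) that unfolding agree_upto_def by blast
  note th = agree_upto_theory_at[OF assms(1)] and D = chain_uptoD[OF assms(2)]
  show ?thesis
    unfolding chain_upto_def
  proof (intro conjI allI impI)
    show "R' x z" if "fst x \<le> k" "fst y \<le> k" "fst z \<le> k" "R' x y" "R' y z" for x y z
      using D(1)[OF that(1-3)] that by (simp add: *)
    show "R' x y \<or> R' y x" if "fst x \<le> k" "fst y \<le> k" for x y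
      using D(2)[OF that] that by (simp add: *)
  qed (use D(3-7) in \<open>simp_all add: * th\<close>)
qed

lemma agree_upto_task_done:
  assumes "agree_upto (Suc k) R R'" "task_done k R t"
  shows "task_done k R' t"
proof -
  have *: "R' x y = R x y" if "fst x \<le> Suc k" "fst y \<le> Suc k" for x y
    using assms(1) that unfolding agree_upto_def by blast
  then show ?thesis
    using assms(2) agree_upto_theory_at[OF assms(1)]
    by (cases t) (auto simp: task_done_def Box_done_def Dia_done_def accessible_def split: if_splits)
qed

lemma saturated_chain:
  assumes "countable (UNIV :: 'v fm set)" and "prime P"
  obtains R where "\<And>k. chain_upto k R" "theory_at R 0 = P"
    "\<And>n \<psi> x. \<not> R x (n, Some (\<^bold>\<box> \<psi>)) \<Longrightarrow>
       \<exists>m. accessible R n m \<and> \<psi> \<notin> theory_at R m \<and> \<not> R x (m, None) \<and> \<not> R (m, None) (n, Some (\<^bold>\<box> \<psi>))"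
    "\<And>n \<psi> x. \<not> R (n, Some (\<^bold>\<diamond> \<psi>)) x \<Longrightarrow>
       \<exists>m. accessible R n m \<and> \<psi> \<in> theory_at R m \<and> \<not> R (m, None) x \<and> \<not> R (n, Some (\<^bold>\<diamond> \<psi>)) (m, None)"
proof -
  have "countable (UNIV :: (nat \<times> 'v fm \<times> bool) set)"
    using assms(1) by (simp flip: UNIV_Times_UNIV)
  then obtain task :: "nat \<Rightarrow> nat \<times> 'v fm \<times> bool" where task: "\<And>t k. \<exists>i\<ge>k. task i = t"
    using repeating_enumeration by blast
  have "\<exists>f. \<forall>k. (chain_upto k (f k) \<and> theory_at (f k) 0 = P) \<and>
      (agree_upto k (f k) (f (Suc k)) \<and> task_done k (f (Suc k)) (task k))"
  proof (rule dependent_nat_choice)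
    show "\<exists>R. chain_upto 0 R \<and> theory_at R 0 = P" using chain_upto_0[OF assms(2)] by blast
  next
    fix R k assume "chain_upto k R \<and> theory_at R 0 = P"
    then show "\<exists>R'. (chain_upto (Suc k) R' \<and> theory_at R' 0 = P) \<and> agree_upto k R R' \<and> task_done k R' (task k)"
      using task_step[of k R "task k"] agree_upto_theory_at by blast
  qed
  then obtain f where f: "\<And>k. chain_upto k (f k)" "theory_at (f 0) 0 = P"
    "\<And>k. agree_upto k (f k) (f (Suc k))" "\<And>k. task_done k (f (Suc k)) (task k)" by blast
  have agree: "agree_upto k (f k) (f j)" if "k \<le> j" for k j
    using that
  proof (induction j rule: dec_induct)
    case (step j)
    then show ?case using f(3)[of j] by (simp add: agree_upto_def)
  qed (simp add: agree_upto_def)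
  \<comment> \<open>A comparison is settled at the first stage containing both worlds and never
    changes afterwards.\<close>
  define R where "R x y = f (max (fst x) (fst y)) x y" for x y
  have R: "agree_upto k (f k) R" for k
    unfolding agree_upto_def
  proof (intro allI impI)
    show "R x y = f k x y" if "fst x \<le> k" "fst y \<le> k" for x y
      using agree[of "max (fst x) (fst y)" k] that
      by (auto simp: agree_upto_def R_def simp del: split_paired_All)
  qed
  have chain: "chain_upto k R" for k using agree_upto_chain_upto[OF R f(1)] .
  have performed: "task_done k R (task k)" for k using agree_upto_task_done[OF R f(4)] .
  show thesis
  proof (rule that)
    show "chain_upto k R" for k by (rule chain)
    show "theory_at R 0 = P" using agree_upto_theory_at[OF R, of 0 0] f(2) by simp
  next
    fix n \<psi> x assume x: "\<not> R x (n, Some (\<^bold>\<box> \<psi>))"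
    \<comment> \<open>The repeated task is taken late enough for x to be among the terms that the
      new bound must undercut.\<close>
    obtain k where k: "k \<ge> max n (fst x)" "task k = (n, \<psi>, True)" using task by blast
    have "\<^bold>\<box> \<psi> \<notin> theory_at R n"
      using x k(1) chain_uptoD(3)[OF chain, of x k n] chain_uptoD(1)[OF chain, of x k "(n, Some \<^bold>\<top>)" "(n, Some (\<^bold>\<box> \<psi>))"]
      by (auto simp: theory_at_def)
    then have "Box_done k R n \<psi>" using performed[of k] k by (simp add: task_done_def)
    then show "\<exists>m. accessible R n m \<and> \<psi> \<notin> theory_at R m \<and> \<not> R x (m, None) \<and> \<not> R (m, None) (n, Some (\<^bold>\<box> \<psi>))"
      using x k(1) unfolding Box_done_def by (meson max.boundedE)
  next
    fix n \<psi> x assume x: "\<not> R (n, Some (\<^bold>\<diamond> \<psi>)) x"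
    obtain k where k: "k \<ge> max n (fst x)" "task k = (n, \<psi>, False)" using task by blast
    have "\<not> R (n, Some (\<^bold>\<diamond> \<psi>)) (n, Some \<^bold>\<bottom>)"
      using x k(1) chain_uptoD(4)[OF chain, of x k n] chain_uptoD(1)[OF chain, of "(n, Some (\<^bold>\<diamond> \<psi>))" k "(n, Some \<^bold>\<bottom>)" x]
      by auto
    then have "Dia_done k R n \<psi>" using performed[of k] k by (simp add: task_done_def)
    then show "\<exists>m. accessible R n m \<and> \<psi> \<in> theory_at R m \<and> \<not> R (m, None) x \<and> \<not> R (n, Some (\<^bold>\<diamond> \<psi>)) (m, None)"
      using x k(1) unfolding Dia_done_def by (meson max.boundedE)
  qed
qed

end

subsection \<open>The canonical model\<close>

text \<open>The interface between the chain and the reals. In \<open>Box_approx\<close>, v m \<psi>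
  < S n m makes the implication under the infimum equal to v m \<psi>; at the trivial values 1 of a
  box and 0 of a diamond nothing needs approximating.\<close>

locale saturated_valuation = calculus \<S> for \<S> :: "'v fm set" +
  fixes v :: "nat \<Rightarrow> 'v fm \<Rightarrow> real" and S :: "nat \<Rightarrow> nat \<Rightarrow> real"
  assumes v_unit: "v n \<phi> \<in> {0..1}"
    and v_Bot: "v n \<^bold>\<bottom> = 0"
    and v_And: "v n (\<phi> \<^bold>\<and> \<psi>) = min (v n \<phi>) (v n \<psi>)"
    and v_Or: "v n (\<phi> \<^bold>\<or> \<psi>) = max (v n \<phi>) (v n \<psi>)"
    and v_Imp: "v n (\<phi> \<^bold>\<rightarrow> \<psi>) = v n \<phi> \<Rightarrow>\<^sub>G v n \<psi>"
    and v_theorem: "{} \<turnstile>\<^bsub>\<S>\<^esub> \<phi> \<Longrightarrow> v n \<phi> = 1"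
    and S_def: "S n m = (INF \<chi>. min (v n (\<^bold>\<box> \<chi>) \<Rightarrow>\<^sub>G v m \<chi>) (v m \<chi> \<Rightarrow>\<^sub>G v n (\<^bold>\<diamond> \<chi>)))"
    and Box_approx: "v n (\<^bold>\<box> \<psi>) < 1 \<Longrightarrow> \<epsilon> > 0 \<Longrightarrow> \<exists>m. v m \<psi> < S n m \<and> v m \<psi> < v n (\<^bold>\<box> \<psi>) + \<epsilon>"
    and Dia_approx: "v n (\<^bold>\<diamond> \<psi>) > 0 \<Longrightarrow> \<epsilon> > 0 \<Longrightarrow> \<exists>m. v n (\<^bold>\<diamond> \<psi>) - \<epsilon> < min (S n m) (v m \<psi>)"
begin

lemma v_le_1: "v n \<phi> \<le> 1" using v_unit[of n \<phi>] by simp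

lemma v_le_if_theorem: "{} \<turnstile>\<^bsub>\<S>\<^esub> \<phi> \<^bold>\<rightarrow> \<psi> \<Longrightarrow> v n \<phi> \<le> v n \<psi>"
  using v_theorem[of "\<phi> \<^bold>\<rightarrow> \<psi>" n] v_le_1[of n \<phi>] by (simp add: v_Imp gimp_eq_1_iff)

lemma S_term_unit: "min (v n (\<^bold>\<box> \<chi>) \<Rightarrow>\<^sub>G v m \<chi>) (v m \<chi> \<Rightarrow>\<^sub>G v n (\<^bold>\<diamond> \<chi>)) \<in> {0..1}"
  using gimp_unit[OF v_unit[of m \<chi>], of "v n (\<^bold>\<box> \<chi>)"] gimp_unit[OF v_unit[of n "\<^bold>\<diamond> \<chi>"], of "v m \<chi>"] by auto

lemma S_unit: "S n m \<in> {0..1}"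
  unfolding S_def by (rule cINF_unit(1)[OF _ S_term_unit]) simp

text \<open>S n m is the greatest degree compatible with all modal values, so a frame property is
  proved by checking the two modal inequalities for its left-hand side.\<close>

lemma le_S_iff:
  assumes "c \<le> 1"
  shows "c \<le> S n m \<longleftrightarrow> (\<forall>\<chi>. min c (v n (\<^bold>\<box> \<chi>)) \<le> v m \<chi> \<and> min c (v m \<chi>) \<le> v n (\<^bold>\<diamond> \<chi>))"
  unfolding S_def using cINF_unit(2)[OF _ S_term_unit[of n _ m], of UNIV c] assms by (simp add: le_gimp_iff)

lemma S_Box: "min (S n m) (v n (\<^bold>\<box> \<chi>)) \<le> v m \<chi>"
  and S_Dia: "min (S n m) (v m \<chi>) \<le> v n (\<^bold>\<diamond> \<chi>)"
  using le_S_iff[of "S n m" n m] S_unit[of n m] by auto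

lemma v_Box: "v n (\<^bold>\<box> \<psi>) = (INF m. S n m \<Rightarrow>\<^sub>G v m \<psi>)"
proof (rule antisym)
  have "v n (\<^bold>\<box> \<psi>) \<le> (S n m \<Rightarrow>\<^sub>G v m \<psi>)" for m
    using S_Box[of n m \<psi>] by (simp add: le_gimp_iff v_le_1 min.commute)
  then show "v n (\<^bold>\<box> \<psi>) \<le> (INF m. S n m \<Rightarrow>\<^sub>G v m \<psi>)" by (intro cINF_greatest) auto
next
  have unit: "(S n m \<Rightarrow>\<^sub>G v m \<psi>) \<in> {0..1}" for m using gimp_unit v_unit by blast
  show "(INF m. S n m \<Rightarrow>\<^sub>G v m \<psi>) \<le> v n (\<^bold>\<box> \<psi>)"
  proof (cases "v n (\<^bold>\<box> \<psi>) < 1")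
    case True
    show ?thesis
    proof (rule field_le_epsilon)
      fix \<epsilon> :: real assume "\<epsilon> > 0"
      then obtain m where m: "v m \<psi> < S n m" "v m \<psi> < v n (\<^bold>\<box> \<psi>) + \<epsilon>" using Box_approx[OF True] by blast
      have "(INF m. S n m \<Rightarrow>\<^sub>G v m \<psi>) \<le> (S n m \<Rightarrow>\<^sub>G v m \<psi>)"
        using cINF_unit(2)[of UNIV "\<lambda>m. S n m \<Rightarrow>\<^sub>G v m \<psi>"] unit by auto
      then show "(INF m. S n m \<Rightarrow>\<^sub>G v m \<psi>) \<le> v n (\<^bold>\<box> \<psi>) + \<epsilon>" using m by (simp add: gimp_def)
    qed
  next
    case False
    then show ?thesis using cINF_unit(1)[of UNIV "\<lambda>m. S n m \<Rightarrow>\<^sub>G v m \<psi>"] unit by auto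
  qed
qed

lemma v_Dia: "v n (\<^bold>\<diamond> \<psi>) = (SUP m. min (S n m) (v m \<psi>))"
proof (rule antisym)
  show "(SUP m. min (S n m) (v m \<psi>)) \<le> v n (\<^bold>\<diamond> \<psi>)" using S_Dia by (intro cSUP_least) auto
next
  have unit: "min (S n m) (v m \<psi>) \<in> {0..1}" for m using S_unit[of n m] v_unit[of m \<psi>] by auto
  show "v n (\<^bold>\<diamond> \<psi>) \<le> (SUP m. min (S n m) (v m \<psi>))"
  proof (cases "v n (\<^bold>\<diamond> \<psi>) > 0")
    case True
    show ?thesis
    proof (rule field_le_epsilon)
      fix \<epsilon> :: real assume "\<epsilon> > 0"
      then obtain m where m: "v n (\<^bold>\<diamond> \<psi>) - \<epsilon> < min (S n m) (v m \<psi>)" using Dia_approx[OF True] by blast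
      have "min (S n m) (v m \<psi>) \<le> (SUP m. min (S n m) (v m \<psi>))"
        using cSUP_unit(2)[of UNIV "\<lambda>m. min (S n m) (v m \<psi>)"] unit by auto
      then show "v n (\<^bold>\<diamond> \<psi>) \<le> (SUP m. min (S n m) (v m \<psi>)) + \<epsilon>" using m by linarith
    qed
  next
    case False
    then show ?thesis using cSUP_unit(1)[of UNIV "\<lambda>m. min (S n m) (v m \<psi>)"] unit by auto
  qed
qed

lemma S_refl: "S n n = 1"
proof -
  have "v n (\<^bold>\<box> \<chi>) \<le> v n \<chi>" "v n \<chi> \<le> v n (\<^bold>\<diamond> \<chi>)" for \<chi>
    using GT_BD_subset by (auto intro!: v_le_if_theorem derives.Ax GT_BD.intros)
  then have "1 \<le> S n n" by (subst le_S_iff) (auto intro: min.coboundedI2)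
  then show ?thesis using S_unit[of n n] by simp
qed

lemma S_trans:
  assumes "GS4_BD \<subseteq> \<S>"
  shows "min (S n m) (S m l) \<le> S n l"
proof -
  have B: "v n (\<^bold>\<box> \<chi>) \<le> v n (\<^bold>\<box> (\<^bold>\<box> \<chi>))" and D: "v n (\<^bold>\<diamond> (\<^bold>\<diamond> \<chi>)) \<le> v n (\<^bold>\<diamond> \<chi>)" for \<chi>
    using assms by (auto intro!: v_le_if_theorem derives.Ax GS4_BD.intros)
  have "min (min (S n m) (S m l)) (v n (\<^bold>\<box> \<chi>)) \<le> v l \<chi>" for \<chi>
    using S_Box[of n m "\<^bold>\<box> \<chi>"] S_Box[of m l \<chi>] B[of \<chi>] by linarith
  moreover have "min (min (S n m) (S m l)) (v l \<chi>) \<le> v n (\<^bold>\<diamond> \<chi>)" for \<chi>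
    using S_Dia[of n m "\<^bold>\<diamond> \<chi>"] S_Dia[of m l \<chi>] D[of \<chi>] by linarith
  moreover have "min (S n m) (S m l) \<le> 1" using S_unit[of n m] by auto
  ultimately show ?thesis by (subst le_S_iff) auto
qed

lemma S_sym:
  assumes "GS5_BD \<subseteq> \<S>"
  shows "S n m = S m n"
proof -
  have "S n m \<le> S m n" for n m
  proof -
    have B: "v n \<chi> \<le> v n (\<^bold>\<box> (\<^bold>\<diamond> \<chi>))" and D: "v n (\<^bold>\<diamond> (\<^bold>\<box> \<chi>)) \<le> v n \<chi>" for \<chi>
      using assms by (auto intro!: v_le_if_theorem derives.Ax GS5_BD.intros)
    \<comment> \<open>Reversing the pair exchanges the modalities: the box condition for (m, n) is
      the diamond condition for (n, m) at \<box>\<chi>, and vice versa.\<close>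
    have "min (S n m) (v m (\<^bold>\<box> \<chi>)) \<le> v n \<chi>" for \<chi>
      using S_Dia[of n m "\<^bold>\<box> \<chi>"] D[of \<chi>] by linarith
    moreover have "min (S n m) (v n \<chi>) \<le> v m (\<^bold>\<diamond> \<chi>)" for \<chi>
      using S_Box[of n m "\<^bold>\<diamond> \<chi>"] B[of \<chi>] by linarith
    moreover have "S n m \<le> 1" using S_unit[of n m] by auto
    ultimately show ?thesis by (subst le_S_iff) auto
  qed
  then show ?thesis by (intro antisym)
qed

end

lemma (in calculus) saturated_valuation_exists:
  assumes count: "countable (UNIV :: 'v fm set)" and P: "prime P"
  obtains v S where "saturated_valuation \<S> v S" "\<And>\<phi>. v 0 \<phi> = 1 \<longleftrightarrow> \<phi> \<in> P"
proof -
  obtain R where chain: "\<And>k. chain_upto k R" and R0: "theory_at R 0 = P"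
    and R_Box: "\<And>n \<psi> x. \<not> R x (n, Some (\<^bold>\<box> \<psi>)) \<Longrightarrow>
       \<exists>m. accessible R n m \<and> \<psi> \<notin> theory_at R m \<and> \<not> R x (m, None) \<and> \<not> R (m, None) (n, Some (\<^bold>\<box> \<psi>))"
    and R_Dia: "\<And>n \<psi> x. \<not> R (n, Some (\<^bold>\<diamond> \<psi>)) x \<Longrightarrow>
       \<exists>m. accessible R n m \<and> \<psi> \<in> theory_at R m \<and> \<not> R (m, None) x \<and> \<not> R (n, Some (\<^bold>\<diamond> \<psi>)) (m, None)"
    using saturated_chain[OF count P] by blast
  have R_trans: "R x z" if "R x y" "R y z" for x y z
    using chain_uptoD(1)[OF chain, of x "max (fst x) (max (fst y) (fst z))" y z] that by simp
  have R_total: "R x y \<or> R y x" for x y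
    using chain_uptoD(2)[OF chain, of x "max (fst x) (fst y)" y] by simp
  have R_top: "R x (n, Some \<^bold>\<top>)" and R_bot: "R (n, Some \<^bold>\<bottom>) x" for x n
    using chain_uptoD(3,4)[OF chain, of x "max (fst x) n" n] by simp_all
  have R_le: "R (n, Some \<phi>) (n, Some \<psi>) \<longleftrightarrow> \<phi> \<^bold>\<rightarrow> \<psi> \<in> theory_at R n"
    and R_None: "R (n, None) (n, Some \<phi>) \<longleftrightarrow> \<phi> \<in> theory_at R n" for n \<phi> \<psi>
    using chain_uptoD(6,7)[OF chain, of n n] by simp_all
  have prime_theory: "prime_theory \<S> (theory_at R n)" for n
    using chain_uptoD(5)[OF chain, of n n] by unfold_locales simp
  \<comment> \<open>All top terms are equivalent, so truth at n may be tested against the top of any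
    world.\<close>
  have in_theory: "\<phi> \<in> theory_at R n \<longleftrightarrow> R (m, Some \<^bold>\<top>) (n, Some \<phi>)" for n m \<phi>
    using R_trans[OF R_top[of "(n, Some \<^bold>\<top>)" m]] R_trans[OF R_top[of "(m, Some \<^bold>\<top>)" n]]
    by (auto simp: theory_at_def)
  interpret bounded_total_preorder R "(0, Some \<^bold>\<bottom>)" "(0, Some \<^bold>\<top>)"
  proof unfold_locales
    show "\<not> R (0, Some \<^bold>\<top>) (0, Some \<^bold>\<bottom>)"
      using prime_theory.bot_notin[OF prime_theory] in_theory by blast
  qed (use R_trans R_total R_top R_bot in blast)+
  have count_tm: "countable (UNIV :: (nat \<times> 'v fm option) set)"
    using count by (simp add: UNIV_option_conv flip: UNIV_Times_UNIV)
  from embedding_exists[OF count_tm] obtain f :: "nat \<times> 'v fm option \<Rightarrow> real"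
    where f: "\<forall>x y. f x \<le> f y \<longleftrightarrow> R x y" and f_bot: "f (0, Some \<^bold>\<bottom>) = 0" and f_top: "f (0, Some \<^bold>\<top>) = 1"
    and above: "\<forall>x. (\<forall>y. \<not> R y x \<longrightarrow> (\<exists>z. \<not> R z x \<and> \<not> R y z)) \<longrightarrow> \<not> R (0, Some \<^bold>\<top>) x \<longrightarrow>
       (\<forall>\<epsilon>>0. \<exists>y. \<not> R y x \<and> f y < f x + \<epsilon>)"
    and below: "\<forall>x. (\<forall>y. \<not> R x y \<longrightarrow> (\<exists>z. \<not> R x z \<and> \<not> R z y)) \<longrightarrow> \<not> R x (0, Some \<^bold>\<bottom>) \<longrightarrow>
       (\<forall>\<epsilon>>0. \<exists>y. \<not> R x y \<and> f x - \<epsilon> < f y)"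
    by (elim exE conjE) (rule that; assumption)
  note f = f[rule_format]
  have f_less: "f x < f y \<longleftrightarrow> \<not> R y x" for x y using f[of y x] by linarith
  have f_unit: "f x \<in> {0..1}" for x
    using f[of "(0, Some \<^bold>\<bottom>)" x] f[of x "(0, Some \<^bold>\<top>)"] R_top R_bot f_bot f_top by simp
  define v where "v n \<phi> = f (n, Some \<phi>)" for n \<phi>
  define S where "S n m = (INF \<chi>. min (v n (\<^bold>\<box> \<chi>) \<Rightarrow>\<^sub>G v m \<chi>) (v m \<chi> \<Rightarrow>\<^sub>G v n (\<^bold>\<diamond> \<chi>)))" for n m
  have v_le: "v n \<phi> \<le> v n \<psi> \<longleftrightarrow> \<phi> \<^bold>\<rightarrow> \<psi> \<in> theory_at R n" for n \<phi> \<psi>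
    by (simp add: v_def f R_le)
  have v_1: "v n \<phi> = 1 \<longleftrightarrow> \<phi> \<in> theory_at R n" for n \<phi>
    using f[of "(0, Some \<^bold>\<top>)" "(n, Some \<phi>)"] f_unit[of "(n, Some \<phi>)"] in_theory f_top by (auto simp: v_def)
  have v_unit: "v n \<phi> \<in> {0..1}" for n \<phi> using f_unit by (simp add: v_def)
  have le_S: "f (m, None) \<le> S n m" if "accessible R n m" for n m
    unfolding S_def
  proof (rule cINF_greatest)
    fix \<chi>
    have "v n (\<^bold>\<box> \<chi>) \<le> v m \<chi>" "v m \<chi> \<le> v n (\<^bold>\<diamond> \<chi>) \<or> f (m, None) \<le> v n (\<^bold>\<diamond> \<chi>)"
      using that by (auto simp: accessible_def v_def f)
    then show "f (m, None) \<le> min (v n (\<^bold>\<box> \<chi>) \<Rightarrow>\<^sub>G v m \<chi>) (v m \<chi> \<Rightarrow>\<^sub>G v n (\<^bold>\<diamond> \<chi>))"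
      using f_unit[of "(m, None)"] by (auto simp: gimp_def)
  qed simp
  have "saturated_valuation \<S> v S"
  proof unfold_locales
    fix n \<phi> \<psi>
    interpret P: prime_theory \<S> "theory_at R n" by (rule prime_theory)
    show "v n \<phi> \<in> {0..1}" by (rule v_unit)
    show "v n \<^bold>\<bottom> = 0"
      using f[of "(n, Some \<^bold>\<bottom>)" "(0, Some \<^bold>\<bottom>)"] f_unit[of "(n, Some \<^bold>\<bottom>)"] R_bot f_bot by (simp add: v_def)
    have "v n (\<phi> \<^bold>\<and> \<psi>) \<le> v n \<phi> \<and> v n (\<phi> \<^bold>\<and> \<psi>) \<le> v n \<psi>" "v n \<phi> \<le> v n (\<phi> \<^bold>\<and> \<psi>) \<or> v n \<psi> \<le> v n (\<phi> \<^bold>\<and> \<psi>)"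
      using P.le_refl P.le_total by (simp_all add: v_le P.and_le_iff) (auto simp: P.le_and_iff P.le_refl)
    then show "v n (\<phi> \<^bold>\<and> \<psi>) = min (v n \<phi>) (v n \<psi>)" by linarith
    have "v n \<phi> \<le> v n (\<phi> \<^bold>\<or> \<psi>) \<and> v n \<psi> \<le> v n (\<phi> \<^bold>\<or> \<psi>)" "v n (\<phi> \<^bold>\<or> \<psi>) \<le> v n \<phi> \<or> v n (\<phi> \<^bold>\<or> \<psi>) \<le> v n \<psi>"
      using P.le_refl P.le_total by (simp_all add: v_le P.le_or_iff) (auto simp: P.or_le_iff P.le_refl)
    then show "v n (\<phi> \<^bold>\<or> \<psi>) = max (v n \<phi>) (v n \<psi>)" by linarith
    show "v n (\<phi> \<^bold>\<rightarrow> \<psi>) = v n \<phi> \<Rightarrow>\<^sub>G v n \<psi>"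
    proof (cases "v n \<phi> \<le> v n \<psi>")
      case True
      then show ?thesis by (simp add: gimp_def v_1 flip: v_le)
    next
      case False
      then have "v n (\<phi> \<^bold>\<rightarrow> \<psi>) \<le> v n \<psi>" "v n \<psi> \<le> v n (\<phi> \<^bold>\<rightarrow> \<psi>)"
        using P.imp_le P.le_imp_iff P.le_refl unfolding v_le by blast+
      then show ?thesis using False by (simp add: gimp_def)
    qed
    show "v n \<phi> = 1" if "{} \<turnstile>\<^bsub>\<S>\<^esub> \<phi>" using P.theorem_in[OF that] by (simp add: v_1)
  next
    show "S n m = (INF \<chi>. min (v n (\<^bold>\<box> \<chi>) \<Rightarrow>\<^sub>G v m \<chi>) (v m \<chi> \<Rightarrow>\<^sub>G v n (\<^bold>\<diamond> \<chi>)))" for n m by (rule S_def)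
  next
    fix n \<psi> and \<epsilon> :: real assume less: "v n (\<^bold>\<box> \<psi>) < 1" and "\<epsilon> > 0"
    moreover have "\<not> R (0, Some \<^bold>\<top>) (n, Some (\<^bold>\<box> \<psi>))"
      using less v_1 in_theory by (metis less_irrefl)
    \<comment> \<open>\<open>R_Box\<close> puts some \<open>(m, None)\<close> strictly between
      \<box>\<psi> and any term above it, so \<box>\<psi> has no immediate successor and
      \<open>above\<close> applies.\<close>
    ultimately obtain y where y: "\<not> R y (n, Some (\<^bold>\<box> \<psi>))" "f y < v n (\<^bold>\<box> \<psi>) + \<epsilon>"
      using above[rule_format, of "(n, Some (\<^bold>\<box> \<psi>))" \<epsilon>] R_Box unfolding v_def by blast
    \<comment> \<open>A second use of \<open>R_Box\<close>, now relative to the close term y, yields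
      a world whose bound is below y and whose \<psi> is below that bound.\<close>
    obtain m where m: "accessible R n m" "\<psi> \<notin> theory_at R m" "\<not> R y (m, None)"
      using R_Box[OF y(1)] by blast
    have "v m \<psi> < f (m, None)" "f (m, None) < f y" using m(2,3) by (simp_all add: v_def f_less R_None)
    then show "\<exists>m. v m \<psi> < S n m \<and> v m \<psi> < v n (\<^bold>\<box> \<psi>) + \<epsilon>"
      using le_S[OF m(1)] y(2) by (intro exI[of _ m]) linarith
  next
    fix n \<psi> and \<epsilon> :: real assume less: "0 < v n (\<^bold>\<diamond> \<psi>)" and "\<epsilon> > 0"
    moreover have "\<not> R (n, Some (\<^bold>\<diamond> \<psi>)) (0, Some \<^bold>\<bottom>)"
      using less f_bot by (simp add: v_def flip: f)
    ultimately obtain y where y: "\<not> R (n, Some (\<^bold>\<diamond> \<psi>)) y" "v n (\<^bold>\<diamond> \<psi>) - \<epsilon> < f y"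
      using below[rule_format, of "(n, Some (\<^bold>\<diamond> \<psi>))" \<epsilon>] R_Dia unfolding v_def by blast
    obtain m where m: "accessible R n m" "\<psi> \<in> theory_at R m" "\<not> R (m, None) y"
      using R_Dia[OF y(1)] by blast
    have "v m \<psi> = 1" "f y < f (m, None)" using m(2,3) by (simp_all add: v_1 f_less)
    then show "\<exists>m. v n (\<^bold>\<diamond> \<psi>) - \<epsilon> < min (S n m) (v m \<psi>)"
      using le_S[OF m(1)] y(2) f_unit[of "(m, None)"] by (intro exI[of _ m]) auto
  qed
  then show thesis using that v_1 R0 by blast
qed

lemma inj_nat_if_infinite:
  assumes "infinite (UNIV :: 'w set)"
  obtains h :: "nat \<Rightarrow> 'w" where "inj h"
  using assms infinite_countable_subset by blast

text \<open>The worlds are numbered by nat, so any infinite type can host a copy. The conditional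
  frame properties let one statement cover all three calculi.\<close>

theorem completeness_countable:
  fixes \<S> :: "'v fm set"
  assumes "GT_BD \<subseteq> \<S>" "countable (UNIV :: 'v fm set)" "infinite (UNIV :: 'w set)" "\<not> T \<turnstile>\<^bsub>\<S>\<^esub> \<phi>"
  obtains M :: "('w, 'v) gk_struct" and x where
    "M \<in> Ref" "GS4_BD \<subseteq> \<S> \<longrightarrow> M \<in> Trans" "GS5_BD \<subseteq> \<S> \<longrightarrow> M \<in> Symm"
    "x \<in> worlds M" "\<forall>\<theta>\<in>T. eval M x \<theta> = 1" "eval M x \<phi> \<noteq> 1"
proof -
  interpret calculus \<S> using assms(1) by unfold_locales
  obtain P where P: "prime P" "T \<subseteq> P" "\<phi> \<notin> P" by (rule prime_extension_single[OF assms(4)])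
  obtain v S where "saturated_valuation \<S> v S" and v0: "\<And>\<phi>. v 0 \<phi> = 1 \<longleftrightarrow> \<phi> \<in> P"
    by (rule saturated_valuation_exists[OF assms(2) P(1)]) blast
  then interpret saturated_valuation \<S> v S by blast
  obtain h :: "nat \<Rightarrow> 'w" where h: "inj h" using inj_nat_if_infinite[OF assms(3)] by blast
  define M :: "('w, 'v) gk_struct" where
    "M = \<lparr>worlds = range h, acc = (\<lambda>x y. S (inv h x) (inv h y)), val = (\<lambda>x p. v (inv h x) (Atom p))\<rparr>"
  have M: "worlds M = range h" "acc M (h n) (h m) = S n m" "val M (h n) p = v n (Atom p)" for n m p
    using h by (simp_all add: M_def)
  have eval: "eval M (h n) \<psi> = v n \<psi>" for n \<psi>
    by (induction \<psi> arbitrary: n) (simp_all add: M v_Bot v_And v_Or v_Imp v_Box v_Dia image_image)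
  have GK: "M \<in> GK" using S_unit v_unit by (auto simp: GK_def M simp del: atLeastAtMost_iff)
  have "M \<in> Ref" using GK S_refl by (auto simp: Ref_def M)
  moreover have "GS4_BD \<subseteq> \<S> \<longrightarrow> M \<in> Trans" using GK S_trans by (auto simp: Trans_def M)
  moreover have "GS5_BD \<subseteq> \<S> \<longrightarrow> M \<in> Symm" using GK S_sym by (auto simp: Symm_def M)
  moreover have "h 0 \<in> worlds M" by (simp add: M)
  moreover have "\<forall>\<theta>\<in>T. eval M (h 0) \<theta> = 1" using P(2) v0 by (auto simp: eval)
  moreover have "eval M (h 0) \<phi> \<noteq> 1" using P(3) v0 by (simp add: eval)
  ultimately show thesis using that by blast
qed

subsection \<open>Renaming variables\<close>

instance fm :: (countable) countable
  by countable_datatype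

text \<open>Replacing variables sends rule instances to rule instances, so only the axioms need
  checking. It carries a derivation over nat variables back to the original ones.\<close>

lemma derives_map:
  assumes "T \<turnstile>\<^bsub>\<S>\<^esub> \<phi>" "map_fm g ` \<S> \<subseteq> \<S>'"
  shows "map_fm g ` T \<turnstile>\<^bsub>\<S>'\<^esub> map_fm g \<phi>"
  using assms
proof (induction rule: derives.induct)
  case (MP T \<S> \<phi> \<psi>)
  then show ?case by (auto intro: derives.MP)
qed (auto intro: derives.intros)

lemma map_Goedel_ax: "\<phi> \<in> Goedel_ax \<Longrightarrow> map_fm g \<phi> \<in> Goedel_ax"
  by (induction rule: Goedel_ax.induct) (auto intro: Goedel_ax.intros)

lemma map_G_BD: "\<phi> \<in> G_BD \<Longrightarrow> map_fm g \<phi> \<in> G_BD"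
  by (induction rule: G_BD.induct) (auto intro: G_BD.intros map_Goedel_ax)

lemma map_GT_BD: "\<phi> \<in> GT_BD \<Longrightarrow> map_fm g \<phi> \<in> GT_BD"
  by (induction rule: GT_BD.induct) (auto intro: GT_BD.intros map_G_BD)

lemma map_GS4_BD: "\<phi> \<in> GS4_BD \<Longrightarrow> map_fm g \<phi> \<in> GS4_BD"
  by (induction rule: GS4_BD.induct) (auto intro: GS4_BD.intros map_GT_BD)

lemma map_GS5_BD: "\<phi> \<in> GS5_BD \<Longrightarrow> map_fm g \<phi> \<in> GS5_BD"
  by (induction rule: GS5_BD.induct) (auto intro: GS5_BD.intros map_GS4_BD)

definition rename :: "('u \<Rightarrow> 'v) \<Rightarrow> ('w, 'v) gk_struct \<Rightarrow> ('w, 'u) gk_struct" where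
  "rename g M = \<lparr>worlds = worlds M, acc = acc M, val = (\<lambda>x p. val M x (g p))\<rparr>"

lemma worlds_rename [simp]: "worlds (rename g M) = worlds M"
  by (simp add: rename_def)

lemma eval_rename: "eval (rename g M) x \<phi> = eval M x (map_fm g \<phi>)"
  by (induction \<phi> arbitrary: x) (simp_all add: rename_def)

lemma rename_Ref: "M \<in> Ref \<Longrightarrow> rename g M \<in> Ref"
  and rename_Trans: "M \<in> Trans \<Longrightarrow> rename g M \<in> Trans"
  and rename_Symm: "M \<in> Symm \<Longrightarrow> rename g M \<in> Symm"
  by (auto simp: Ref_def Trans_def Symm_def GK_def rename_def)

text \<open>The type of variables may be uncountable, but T and \<phi> mention only countably many.
  These are coded by f with inverse g on them: a derivation of the coded formula would map back
  under g, and a countermodel of the coded problem is pulled back along f.\<close>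

lemma completeness:
  fixes T :: "'v fm set" and \<S>' :: "nat fm set"
  assumes "countable T" "infinite (UNIV :: 'w set)" "\<not> T \<turnstile>\<^bsub>\<S>\<^esub> \<phi>"
    and "GT_BD \<subseteq> \<S>'" "\<And>(g :: nat \<Rightarrow> 'v) \<psi>. \<psi> \<in> \<S>' \<Longrightarrow> map_fm g \<psi> \<in> \<S>"
  obtains M :: "('w, 'v) gk_struct" and x where
    "M \<in> Ref" "GS4_BD \<subseteq> \<S>' \<longrightarrow> M \<in> Trans" "GS5_BD \<subseteq> \<S>' \<longrightarrow> M \<in> Symm"
    "x \<in> worlds M" "\<forall>\<theta>\<in>T. eval M x \<theta> = 1" "eval M x \<phi> \<noteq> 1"
proof -
  define V where "V = (\<Union>\<theta>\<in>insert \<phi> T. set_fm \<theta>)"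
  have "finite (set_fm \<theta>)" for \<theta> :: "'v fm" by (induction \<theta>) auto
  then have V: "countable V" using assms(1) by (auto simp: V_def countable_finite)
  define f where "f = to_nat_on V"
  define g where "g = from_nat_into V"
  have gf_id: "g (f p) = p" if "p \<in> V" for p
    using V that by (simp add: f_def g_def)
  have "map_fm (g \<circ> f) \<theta> = \<theta>" if "\<theta> \<in> insert \<phi> T" for \<theta>
    using that gf_id by (intro fm.map_ident_strong) (auto simp: V_def)
  then have gf: "map_fm g (map_fm f \<theta>) = \<theta>" if "\<theta> \<in> insert \<phi> T" for \<theta>
    using that by (simp add: fm.map_comp)
  have "map_fm g ` map_fm f ` T = T" using gf by (force simp: image_image)
  moreover have "map_fm g ` \<S>' \<subseteq> \<S>" using assms(5) by blast
  ultimately have "\<not> map_fm f ` T \<turnstile>\<^bsub>\<S>'\<^esub> map_fm f \<phi>"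
    using assms(3) derives_map[of "map_fm f ` T" \<S>' "map_fm f \<phi>" g \<S>] gf[of \<phi>] by auto
  then obtain M :: "('w, nat) gk_struct" and x where M: "M \<in> Ref" "GS4_BD \<subseteq> \<S>' \<longrightarrow> M \<in> Trans" "GS5_BD \<subseteq> \<S>' \<longrightarrow> M \<in> Symm"
    "x \<in> worlds M" "\<forall>\<theta>\<in>map_fm f ` T. eval M x \<theta> = 1" "eval M x (map_fm f \<phi>) \<noteq> 1"
    by (rule completeness_countable[OF assms(4) countableI_type assms(2)]) blast
  then show thesis
    using that[of "rename f M" x] by (simp add: eval_rename rename_Ref rename_Trans rename_Symm)
qed

theorem theorem5p1:
  fixes T :: "'v fm set" and \<phi> :: "'v fm"
  assumes "countable T"
    and "infinite (UNIV :: 'w set)"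
  shows "(T \<turnstile>\<^bsub>GT_BD\<^esub> \<phi> \<longleftrightarrow> T \<Turnstile>\<^bsub>(Ref :: ('w, 'v) gk_struct set)\<^esub> \<phi>) \<and>
         (T \<turnstile>\<^bsub>GS4_BD\<^esub> \<phi> \<longleftrightarrow> T \<Turnstile>\<^bsub>(Ref \<inter> Trans :: ('w, 'v) gk_struct set)\<^esub> \<phi>) \<and>
         (T \<turnstile>\<^bsub>GS5_BD\<^esub> \<phi> \<longleftrightarrow> T \<Turnstile>\<^bsub>(Ref \<inter> Trans \<inter> Symm :: ('w, 'v) gk_struct set)\<^esub> \<phi>)"
proof -
  have sound: "T \<Turnstile>\<^bsub>C\<^esub> \<phi>" if "T \<turnstile>\<^bsub>\<S>\<^esub> \<phi>" "C \<subseteq> GK" "\<And>M. M \<in> C \<Longrightarrow> validates M \<S>"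
    for \<S> and C :: "('w, 'v) gk_struct set"
    unfolding entails_def
  proof (intro ballI impI)
    fix M x assume M: "M \<in> C" "x \<in> worlds M" "\<forall>\<theta>\<in>T. eval M x \<theta> = 1"
    show "eval M x \<phi> = 1"
      by (rule soundness[OF that(1) _ that(3)[OF M(1)] M(2)]) (use M that(2) in auto)
  qed
  have sub: "GT_BD \<subseteq> (GS4_BD :: nat fm set)" "GS4_BD \<subseteq> (GS5_BD :: nat fm set)"
    by (auto intro: GS4_BD.intros GS5_BD.intros)
  have Ref: "(Ref :: ('w, 'v) gk_struct set) \<subseteq> GK" by (auto simp: Ref_def)
  have "T \<turnstile>\<^bsub>GT_BD\<^esub> \<phi>" if "T \<Turnstile>\<^bsub>(Ref :: ('w, 'v) gk_struct set)\<^esub> \<phi>"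
  proof (rule ccontr)
    assume "\<not> T \<turnstile>\<^bsub>GT_BD\<^esub> \<phi>"
    then obtain M :: "('w, 'v) gk_struct" and x where "M \<in> Ref" "x \<in> worlds M"
      "\<forall>\<theta>\<in>T. eval M x \<theta> = 1" "eval M x \<phi> \<noteq> 1"
      by (rule completeness[OF assms _ subset_refl map_GT_BD]) (use sub in \<open>simp_all, blast?\<close>)
    then show False using that by (auto simp: entails_def)
  qed
  moreover have "T \<turnstile>\<^bsub>GS4_BD\<^esub> \<phi>" if "T \<Turnstile>\<^bsub>(Ref \<inter> Trans :: ('w, 'v) gk_struct set)\<^esub> \<phi>"
  proof (rule ccontr)
    assume "\<not> T \<turnstile>\<^bsub>GS4_BD\<^esub> \<phi>"
    then obtain M :: "('w, 'v) gk_struct" and x where "M \<in> Ref \<inter> Trans" "x \<in> worlds M"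
      "\<forall>\<theta>\<in>T. eval M x \<theta> = 1" "eval M x \<phi> \<noteq> 1"
      by (rule completeness[OF assms _ sub(1) map_GS4_BD]) (use sub in \<open>simp_all, blast?\<close>)
    then show False using that by (auto simp: entails_def)
  qed
  moreover have "T \<turnstile>\<^bsub>GS5_BD\<^esub> \<phi>" if "T \<Turnstile>\<^bsub>(Ref \<inter> Trans \<inter> Symm :: ('w, 'v) gk_struct set)\<^esub> \<phi>"
  proof (rule ccontr)
    assume "\<not> T \<turnstile>\<^bsub>GS5_BD\<^esub> \<phi>"
    then obtain M :: "('w, 'v) gk_struct" and x where "M \<in> Ref \<inter> Trans \<inter> Symm" "x \<in> worlds M"
      "\<forall>\<theta>\<in>T. eval M x \<theta> = 1" "eval M x \<phi> \<noteq> 1"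
      by (rule completeness[OF assms _ order_trans[OF sub] map_GS5_BD]) (use sub in \<open>simp_all, blast?\<close>)
    then show False using that by (auto simp: entails_def)
  qed
  moreover have "T \<turnstile>\<^bsub>GT_BD\<^esub> \<phi> \<Longrightarrow> T \<Turnstile>\<^bsub>(Ref :: ('w, 'v) gk_struct set)\<^esub> \<phi>"
    by (rule sound) (use Ref validates_GT_BD in auto)
  moreover have "T \<turnstile>\<^bsub>GS4_BD\<^esub> \<phi> \<Longrightarrow> T \<Turnstile>\<^bsub>(Ref \<inter> Trans :: ('w, 'v) gk_struct set)\<^esub> \<phi>"
    by (rule sound) (use Ref validates_GS4_BD in auto)
  moreover have "T \<turnstile>\<^bsub>GS5_BD\<^esub> \<phi> \<Longrightarrow> T \<Turnstile>\<^bsub>(Ref \<inter> Trans \<inter> Symm :: ('w, 'v) gk_struct set)\<^esub> \<phi>"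
    by (rule sound) (use Ref validates_GS5_BD in auto)
  ultimately show ?thesis by blast
qed

end
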